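(* Let $\mathcal{A}$ be a finite poset and let $\hat{\mathcal{A}}_f$ be the category of presheaves over $\mathcal{A}$ with values in finite sets, with natural transformations as morphisms. For a presheaf $F$ in $\hat{\mathcal{A}}_f$, equip each $\widetilde F_a=\mathbb{R}^{F_a}$, $a\in\mathcal{A}$, with any scalar product $\langle\cdot,\cdot\rangle_a$; this in turn equips the message space $F_{\rightarrow}$ with a scalar product. Define $$\Delta MP(F):F_{\rightarrow}\times\prod_{a\in\mathcal{A}}\mathbb{R}^{F_a}\to F_{\rightarrow},\qquad \Delta MP(F)(l,H)=\Delta MP_{F,H}(l)\quad\Big(l\in F_{\rightarrow},\ H\in\prod_{a\in\mathcal{A}}\mathbb{R}^{F_a}\Big).$$ For a natural transformation $\phi:F\to G$ between two presheaves of $\hat{\mathcal{A}}_f$, let $\Delta MP(\phi)=(\phi_1,\psi)$, where $$\psi(H)_a(y_a)=-\ln\sum_{x_a\in F_a:\ \phi_a(x_a)=y_a}e^{-H_a(x_a)}\qquad(a\in\mathcal{A},\ y_a\in G_a).$$ Then $\Delta MP(\phi)$ is a morphism from $\Delta MP(F)$ to $\Delta MP(G)$ in the category $\mathbf{MPA}$. Furthermore, $\Delta MP$ is a functor from $\hat{\mathcal{A}}_f$ to $\mathbf{MPA}$.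
   Context: A presheaf $F$ over a finite poset $(\mathcal{A},\le)$ with values in finite sets assigns to each $a\in\mathcal{A}$ a finite set $F_a$ and to each pair $b\le a$ a map $F^a_b:F_a\to F_b$, with $F^a_a=\mathrm{id}$ and $F^b_c\circ F^a_b=F^a_c$ for $c\le b\le a$. A natural transformation $\phi:F\to G$ is a family of maps $\phi_a:F_a\to G_a$ with $G^a_b\circ\phi_a=\phi_b\circ F^a_b$ for all $b\le a$. Linearization: $\widetilde F_a=\mathbb{R}^{F_a}$, and for $b\le a$ the linear map $\widetilde F^a_b:\widetilde F_a\to\widetilde F_b$ is the pushforward $\widetilde F^a_b(\lambda)(x)=\sum_{y\in F_a:\,F^a_b(y)=x}\lambda(y)$. Likewise $\widetilde\phi_a:\widetilde F_a\to\widetilde G_a$, $\widetilde\phi_a(h)(y)=\sum_{x\in F_a:\,\phi_a(x)=y}h(x)$. Given a scalar product $\langle\cdot,\cdot\rangle_a$ on each $\widetilde F_a$, let $\widetilde F^{a,\dagger}_b:\widetilde F_b\to\widetilde F_a$ be the adjoint of $\widetilde F^a_b$. The space of messages is $F_{\rightarrow}=\bigoplus_{a,b\in\mathcal{A}:\,b\le a}\widetilde F_b$, with elements written $l=(l_{a\to b})_{b\le a}$, $l_{a\to b}\in\widetilde F_b$, and scalar product $\langle l,l'\rangle=\sum_{b\le a}\langle l_{a\to b},l'_{a\to b}\rangle_b$. Operators: - $\delta_F:\bigoplus_a\widetilde F_a\to F_{\rightarrow}$, $\delta_F(v)_{a\to b}=\widetilde F^a_b(v_a)-v_b$. - $d_{F^\dagger}:F_{\rightarrow}\to\bigoplus_a\widetilde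 F_a$, $d_{F^\dagger}(l)_a=\sum_{b\le a}\widetilde F^{a,\dagger}_b(l_{a\to b})-\sum_{b\ge a}l_{b\to a}$. - $\zeta_{F^\dagger}:\bigoplus_a\widetilde F_a\to\bigoplus_a\widetilde F_a$, $\zeta_{F^\dagger}(v)_a=\sum_{b\le a}\widetilde F^{a,\dagger}_b(v_b)$. - For Hamiltonians $H=(H_a:F_a\to\mathbb{R})_{a\in\mathcal{A}}$, $g_H^{\langle\cdot,\cdot\rangle}:\bigoplus_a\widetilde F_a\to\bigoplus_a\widetilde F_a$ is given by $g_H^{\langle\cdot,\cdot\rangle}(v)_a(x)=\exp\big(-H_a(x)+\langle v_a,1_x\rangle_a-1\big)$ for $x\in F_a$, where $1_x\in\mathbb{R}^{F_a}$ is the indicator function of $x$. The message-passing increment is $\Delta MP_{F,H}=\delta_F\circ g_H^{\langle\cdot,\cdot\rangle}\circ\zeta_{F^\dagger}\circ d_{F^\dagger}:F_{\rightarrow}\to F_{\rightarrow}$. Convention: if $y_a\notin\operatorname{im}\phi_a$, then $\psi(H)_a(y_a)=+\infty$; by convention Hamiltonians are allowed to take the value $+\infty$ at some points, with $e^{-\infty}=0$. The map $\phi_1:F_{\rightarrow}\to G_{\rightarrow}$ is $\phi_1(v)_{a\to b}=\widetilde\phi_b(v_{a\to b})$. The category $\mathbf{MPA}$: objects are maps $D:\mathcal{H}\times S\to\mathcal{H}$ with $\mathcal{H}$ a Hilbert space and $S$ a topological space. A morphism from $D_0:\mathcal{H}_0\times S_0\to\mathcal{H}_0$ to $D_1:\mathcal{H}_1\times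 S_1\to\mathcal{H}_1$ is a pair $(\alpha,\beta)$ with $\alpha:\mathcal{H}_0\to\mathcal{H}_1$ bounded linear and $\beta:S_0\to S_1$ continuous such that $D_1(x,\beta(s))=\alpha\big(D_0(\alpha^\dagger(x),s)\big)$ for all $x\in\mathcal{H}_1$, $s\in S_0$, where $\alpha^\dagger$ is the adjoint. Composition is componentwise. The parameter space $\prod_{a}\mathbb{R}^{F_a}$ is a finite-dimensional vector space with the topology given by any norm, for example $\|H\|_\infty=\sup_{a\in\mathcal{A}}\sup_{x_a\in F_a}|H_a(x_a)|$.
   Formalization: Since ψ(H) equals +∞ off the image of φ, it need not lie in the product of the real spaces ℝ^{G_a}; the parameter space is therefore taken to be the product of (−∞,+∞]^{F_a} with the product topology, in which the real Hamiltonians embed with their usual topology. *)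

theory Defs
  imports "HOL-Analysis.Analysis" "HOL-Algebra.Module"
begin

section \<open>Categories and functors\<close>

record ('o, 'm) category =
  Obj :: "'o set"
  Hom :: "'o \<Rightarrow> 'o \<Rightarrow> 'm set"
  Ident :: "'o \<Rightarrow> 'm"
  Comp :: "'o \<Rightarrow> 'o \<Rightarrow> 'o \<Rightarrow> 'm \<Rightarrow> 'm \<Rightarrow> 'm"
    \<comment> \<open>\<open>Comp C X Y Z g f\<close> is the composite of \<open>f : X \<rightarrow> Y\<close> followed by \<open>g : Y \<rightarrow> Z\<close>\<close>

locale category =
  fixes C :: "('o, 'm) category"
  assumes ident_in_hom: "X \<in> Obj C \<Longrightarrow> Ident C X \<in> Hom C X X"
    and comp_in_hom: "\<lbrakk>X \<in> Obj C; Y \<in> Obj C; Z \<in> Obj C; f \<in> Hom C X Y; g \<in> Hom C Y Z\<rbrakk>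
      \<Longrightarrow> Comp C X Y Z g f \<in> Hom C X Z"
    and comp_ident_right: "\<lbrakk>X \<in> Obj C; Y \<in> Obj C; f \<in> Hom C X Y\<rbrakk>
      \<Longrightarrow> Comp C X X Y f (Ident C X) = f"
    and comp_ident_left: "\<lbrakk>X \<in> Obj C; Y \<in> Obj C; f \<in> Hom C X Y\<rbrakk>
      \<Longrightarrow> Comp C X Y Y (Ident C Y) f = f"
    and comp_assoc: "\<lbrakk>W \<in> Obj C; X \<in> Obj C; Y \<in> Obj C; Z \<in> Obj C;
        f \<in> Hom C W X; g \<in> Hom C X Y; h \<in> Hom C Y Z\<rbrakk>
      \<Longrightarrow> Comp C W Y Z h (Comp C W X Y g f) = Comp C W X Z (Comp C X Y Z h g) f"

locale category_functor = C: category C + D: category D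
  for C :: "('o, 'm) category" and D :: "('p, 'n) category" +
  fixes Fobj :: "'o \<Rightarrow> 'p" and Farr :: "'o \<Rightarrow> 'o \<Rightarrow> 'm \<Rightarrow> 'n"
  assumes obj_in_obj: "X \<in> Obj C \<Longrightarrow> Fobj X \<in> Obj D"
    and arr_in_hom: "\<lbrakk>X \<in> Obj C; Y \<in> Obj C; f \<in> Hom C X Y\<rbrakk>
      \<Longrightarrow> Farr X Y f \<in> Hom D (Fobj X) (Fobj Y)"
    and arr_ident: "X \<in> Obj C \<Longrightarrow> Farr X X (Ident C X) = Ident D (Fobj X)"
    and arr_comp: "\<lbrakk>X \<in> Obj C; Y \<in> Obj C; Z \<in> Obj C; f \<in> Hom C X Y; g \<in> Hom C Y Z\<rbrakk>
      \<Longrightarrow> Farr X Z (Comp C X Y Z g f)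
        = Comp D (Fobj X) (Fobj Y) (Fobj Z) (Farr Y Z g) (Farr X Y f)"


section \<open>Real Hilbert spaces on a carrier set\<close>

definition real_ring :: "real ring" where
  "real_ring = \<lparr>carrier = UNIV, mult = (*), one = 1, zero = 0, add = (+)\<rparr>"

record 'v ip_module = "(real, 'v) module" +
  iprod :: "'v \<Rightarrow> 'v \<Rightarrow> real"

definition inner_product_space :: "'v ip_module \<Rightarrow> bool" where
  "inner_product_space V \<longleftrightarrow>
     Module.module real_ring V \<and>
     (\<forall>x\<in>carrier V. \<forall>y\<in>carrier V. iprod V x y = iprod V y x) \<and>
     (\<forall>x\<in>carrier V. \<forall>y\<in>carrier V. \<forall>z\<in>carrier V.
        iprod V (x \<oplus>\<^bsub>V\<^esub> y) z = iprod V x z + iprod V y z) \<and>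
     (\<forall>c. \<forall>x\<in>carrier V. \<forall>y\<in>carrier V. iprod V (c \<odot>\<^bsub>V\<^esub> x) y = c * iprod V x y) \<and>
     (\<forall>x\<in>carrier V. x \<noteq> \<zero>\<^bsub>V\<^esub> \<longrightarrow> 0 < iprod V x x)"

definition vnorm :: "'v ip_module \<Rightarrow> 'v \<Rightarrow> real" where
  "vnorm V x = sqrt (iprod V x x)"

text \<open>The locale \<open>Metric_space\<close> asks for a symmetric nonnegative distance on the whole
  type, hence the value 0 outside the carrier.\<close>

definition vdist :: "'v ip_module \<Rightarrow> 'v \<Rightarrow> 'v \<Rightarrow> real" where
  "vdist V x y = (if x \<in> carrier V \<and> y \<in> carrier V then vnorm V (x \<ominus>\<^bsub>V\<^esub> y) else 0)"

definition hilbert_space :: "'v ip_module \<Rightarrow> bool" where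
  "hilbert_space V \<longleftrightarrow>
     inner_product_space V \<and> Metric_space.mcomplete (carrier V) (vdist V)"

text \<open>Maps are extensional (\<open>undefined\<close> outside their domain), so that equality of
  maps is the usual one.\<close>

definition bounded_linear_map :: "'v ip_module \<Rightarrow> 'w ip_module \<Rightarrow> ('v \<Rightarrow> 'w) \<Rightarrow> bool" where
  "bounded_linear_map V W f \<longleftrightarrow>
     f \<in> carrier V \<rightarrow>\<^sub>E carrier W \<and>
     (\<forall>x\<in>carrier V. \<forall>y\<in>carrier V. f (x \<oplus>\<^bsub>V\<^esub> y) = f x \<oplus>\<^bsub>W\<^esub> f y) \<and>
     (\<forall>c. \<forall>x\<in>carrier V. f (c \<odot>\<^bsub>V\<^esub> x) = c \<odot>\<^bsub>W\<^esub> f x) \<and>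
     (\<exists>K. \<forall>x\<in>carrier V. vnorm W (f x) \<le> K * vnorm V x)"

text \<open>For a bounded linear map between Hilbert spaces such a map exists (Riesz) and is
  unique.\<close>

definition adjoint :: "'v ip_module \<Rightarrow> 'w ip_module \<Rightarrow> ('v \<Rightarrow> 'w) \<Rightarrow> 'w \<Rightarrow> 'v" where
  "adjoint V W f = (THE g. g \<in> carrier W \<rightarrow>\<^sub>E carrier V \<and>
     (\<forall>x\<in>carrier V. \<forall>y\<in>carrier W. iprod W (f x) y = iprod V x (g y)))"

text \<open>The real vector space \<open>\<real>\<^sup>X\<close> with scalar product \<open>p\<close>. The fields \<open>mult\<close> and \<open>one\<close>
  that the record type of modules inherits from rings play no role.\<close>

definition free_space :: "'x set \<Rightarrow> (('x \<Rightarrow> real) \<Rightarrow> ('x \<Rightarrow> real) \<Rightarrow> real) \<Rightarrow> ('x \<Rightarrow> real) ip_module"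
  where
  "free_space X p =
     \<lparr>carrier = X \<rightarrow>\<^sub>E UNIV, mult = undefined, one = undefined,
      zero = (\<lambda>x\<in>X. 0), add = (\<lambda>f g. \<lambda>x\<in>X. f x + g x),
      smult = (\<lambda>c f. \<lambda>x\<in>X. c * f x), iprod = p\<rparr>"

definition direct_sum :: "'i set \<Rightarrow> ('i \<Rightarrow> 'v ip_module) \<Rightarrow> ('i \<Rightarrow> 'v) ip_module" where
  "direct_sum I V =
     \<lparr>carrier = (\<Pi>\<^sub>E i\<in>I. carrier (V i)), mult = undefined, one = undefined,
      zero = (\<lambda>i\<in>I. \<zero>\<^bsub>V i\<^esub>), add = (\<lambda>f g. \<lambda>i\<in>I. f i \<oplus>\<^bsub>V i\<^esub> g i),
      smult = (\<lambda>c f. \<lambda>i\<in>I. c \<odot>\<^bsub>V i\<^esub> f i),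
      iprod = (\<lambda>f g. \<Sum>i\<in>I. iprod (V i) (f i) (g i))\<rparr>"


section \<open>The category MPA\<close>

record ('v, 's) mpa =
  hilb :: "'v ip_module"
  par :: "'s topology"
  act :: "'v \<times> 's \<Rightarrow> 'v"

definition mpa_obj :: "('v, 's) mpa \<Rightarrow> bool" where
  "mpa_obj D \<longleftrightarrow>
     hilbert_space (hilb D) \<and>
     act D \<in> carrier (hilb D) \<times> topspace (par D) \<rightarrow>\<^sub>E carrier (hilb D)"

definition mpa_hom ::
  "('v, 's) mpa \<Rightarrow> ('v, 's) mpa \<Rightarrow> (('v \<Rightarrow> 'v) \<times> ('s \<Rightarrow> 's)) set" where
  "mpa_hom D0 D1 = {(\<alpha>, \<beta>).
     bounded_linear_map (hilb D0) (hilb D1) \<alpha> \<and>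
     \<beta> \<in> extensional (topspace (par D0)) \<and>
     continuous_map (par D0) (par D1) \<beta> \<and>
     (\<forall>x\<in>carrier (hilb D1). \<forall>s\<in>topspace (par D0).
        act D1 (x, \<beta> s) = \<alpha> (act D0 (adjoint (hilb D0) (hilb D1) \<alpha> x, s)))}"

definition MPA :: "(('v, 's) mpa, ('v \<Rightarrow> 'v) \<times> ('s \<Rightarrow> 's)) category" where
  "MPA =
     \<lparr>Obj = {D. mpa_obj D},
      Hom = mpa_hom,
      Ident = (\<lambda>D. (\<lambda>x\<in>carrier (hilb D). x, \<lambda>s\<in>topspace (par D). s)),
      Comp = (\<lambda>D0 D1 D2 (\<alpha>', \<beta>') (\<alpha>, \<beta>).
        (compose (carrier (hilb D0)) \<alpha>' \<alpha>, compose (topspace (par D0)) \<beta>' \<beta>))\<rparr>"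


section \<open>Presheaves of finite sets over a finite poset\<close>

text \<open>The poset is a set \<open>A\<close> of elements of an ordered type, with the induced order. The
  map \<open>F\<^sup>a\<^sub>b\<close>, for \<open>b \<le> a\<close>, is \<open>res F (a, b)\<close>.\<close>

definition below :: "'a::order set \<Rightarrow> ('a \<times> 'a) set" where
  "below A = {(a, b). a \<in> A \<and> b \<in> A \<and> b \<le> a}"

record ('a, 'x) presheaf =
  ob :: "'a \<Rightarrow> 'x set"
  res :: "'a \<times> 'a \<Rightarrow> 'x \<Rightarrow> 'x"

definition presheaves :: "'a::order set \<Rightarrow> ('a, 'x) presheaf set" where
  "presheaves A = {F.
     ob F \<in> A \<rightarrow>\<^sub>E {X. finite X} \<and>
     res F \<in> (\<Pi>\<^sub>E (a, b)\<in>below A. ob F a \<rightarrow>\<^sub>E ob F b) \<and>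
     (\<forall>a\<in>A. \<forall>x\<in>ob F a. res F (a, a) x = x) \<and>
     (\<forall>a\<in>A. \<forall>b\<in>A. \<forall>c\<in>A. c \<le> b \<and> b \<le> a \<longrightarrow>
        (\<forall>x\<in>ob F a. res F (b, c) (res F (a, b) x) = res F (a, c) x))}"

definition nat_trans ::
  "'a::order set \<Rightarrow> ('a, 'x) presheaf \<Rightarrow> ('a, 'x) presheaf \<Rightarrow> ('a \<Rightarrow> 'x \<Rightarrow> 'x) set" where
  "nat_trans A F G = {\<phi>.
     \<phi> \<in> (\<Pi>\<^sub>E a\<in>A. ob F a \<rightarrow>\<^sub>E ob G a) \<and>
     (\<forall>(a, b)\<in>below A. \<forall>x\<in>ob F a. res G (a, b) (\<phi> a x) = \<phi> b (res F (a, b) x))}"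

definition Psh :: "'a::order set \<Rightarrow> (('a, 'x) presheaf, 'a \<Rightarrow> 'x \<Rightarrow> 'x) category" where
  "Psh A =
     \<lparr>Obj = presheaves A,
      Hom = nat_trans A,
      Ident = (\<lambda>F. \<lambda>a\<in>A. \<lambda>x\<in>ob F a. x),
      Comp = (\<lambda>F G K \<theta> \<phi>. \<lambda>a\<in>A. compose (ob F a) (\<theta> a) (\<phi> a))\<rparr>"


section \<open>The message-passing operators\<close>

text \<open>\<open>ip F a\<close> is the scalar product chosen on the linearization of \<open>F\<^sub>a\<close>.\<close>

type_synonym ('a, 'x) scalar_products =
  "('a, 'x) presheaf \<Rightarrow> 'a \<Rightarrow> ('x \<Rightarrow> real) \<Rightarrow> ('x \<Rightarrow> real) \<Rightarrow> real"

definition pushforward :: "'x set \<Rightarrow> 'y set \<Rightarrow> ('x \<Rightarrow> 'y) \<Rightarrow> ('x \<Rightarrow> real) \<Rightarrow> 'y \<Rightarrow> real" where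
  "pushforward X Y f = (\<lambda>h\<in>X \<rightarrow>\<^sub>E UNIV. \<lambda>y\<in>Y. \<Sum>x\<in>{x \<in> X. f x = y}. h x)"

definition lin :: "('a, 'x) scalar_products \<Rightarrow> ('a, 'x) presheaf \<Rightarrow> 'a \<Rightarrow> ('x \<Rightarrow> real) ip_module"
  where
  "lin ip F a = free_space (ob F a) (ip F a)"

definition lin_res :: "('a, 'x) presheaf \<Rightarrow> 'a \<Rightarrow> 'a \<Rightarrow> ('x \<Rightarrow> real) \<Rightarrow> 'x \<Rightarrow> real" where
  "lin_res F a b = pushforward (ob F a) (ob F b) (res F (a, b))"

definition lin_res_adj ::
  "('a, 'x) scalar_products \<Rightarrow> ('a, 'x) presheaf \<Rightarrow> 'a \<Rightarrow> 'a \<Rightarrow> ('x \<Rightarrow> real) \<Rightarrow> 'x \<Rightarrow> real" where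
  "lin_res_adj ip F a b = adjoint (lin ip F a) (lin ip F b) (lin_res F a b)"

definition messages ::
  "'a::order set \<Rightarrow> ('a, 'x) scalar_products \<Rightarrow> ('a, 'x) presheaf
    \<Rightarrow> ('a \<times> 'a \<Rightarrow> 'x \<Rightarrow> real) ip_module" where
  "messages A ip F = direct_sum (below A) (\<lambda>(a, b). lin ip F b)"

definition delta_op ::
  "'a::order set \<Rightarrow> ('a, 'x) scalar_products \<Rightarrow> ('a, 'x) presheaf
    \<Rightarrow> ('a \<Rightarrow> 'x \<Rightarrow> real) \<Rightarrow> ('a \<times> 'a \<Rightarrow> 'x \<Rightarrow> real)" where
  "delta_op A ip F v = (\<lambda>(a, b)\<in>below A. lin_res F a b (v a) \<ominus>\<^bsub>lin ip F b\<^esub> v b)"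

definition d_op ::
  "'a::order set \<Rightarrow> ('a, 'x) scalar_products \<Rightarrow> ('a, 'x) presheaf
    \<Rightarrow> ('a \<times> 'a \<Rightarrow> 'x \<Rightarrow> real) \<Rightarrow> ('a \<Rightarrow> 'x \<Rightarrow> real)" where
  "d_op A ip F l = (\<lambda>a\<in>A.
     (\<Oplus>\<^bsub>lin ip F a\<^esub>b\<in>{b \<in> A. b \<le> a}. lin_res_adj ip F a b (l (a, b)))
     \<ominus>\<^bsub>lin ip F a\<^esub> (\<Oplus>\<^bsub>lin ip F a\<^esub>b\<in>{b \<in> A. a \<le> b}. l (b, a)))"

definition zeta_op ::
  "'a::order set \<Rightarrow> ('a, 'x) scalar_products \<Rightarrow> ('a, 'x) presheaf
    \<Rightarrow> ('a \<Rightarrow> 'x \<Rightarrow> real) \<Rightarrow> ('a \<Rightarrow> 'x \<Rightarrow> real)" where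
  "zeta_op A ip F v = (\<lambda>a\<in>A.
     \<Oplus>\<^bsub>lin ip F a\<^esub>b\<in>{b \<in> A. b \<le> a}. lin_res_adj ip F a b (v b))"

text \<open>Hamiltonians may take the value \<open>+\<infinity>\<close>. The exponential below is only used at
  arguments different from \<open>+\<infinity>\<close>, the logarithm only at nonnegative arguments.\<close>

definition exp_ext :: "ereal \<Rightarrow> real" where
  "exp_ext t = (if t = - \<infinity> then 0 else exp (real_of_ereal t))"

definition ln_ext :: "real \<Rightarrow> ereal" where
  "ln_ext t = (if t = 0 then - \<infinity> else ereal (ln t))"

text \<open>The space of Hamiltonians carries the product of the usual topology of
  \<open>(-\<infinity>, +\<infinity>]\<close>. Lemma \<open>real_hamiltonians_embedding\<close> below shows that the real-valued
  Hamiltonians form a subspace with the usual topology of a finite-dimensional space.\<close>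

definition hamiltonians ::
  "'a set \<Rightarrow> ('a, 'x) presheaf \<Rightarrow> ('a \<Rightarrow> 'x \<Rightarrow> ereal) topology" where
  "hamiltonians A F = product_topology
     (\<lambda>a. product_topology (\<lambda>x. subtopology euclidean {h. h \<noteq> - \<infinity>}) (ob F a)) A"

definition g_op ::
  "'a set \<Rightarrow> ('a, 'x) scalar_products \<Rightarrow> ('a, 'x) presheaf \<Rightarrow> ('a \<Rightarrow> 'x \<Rightarrow> ereal)
    \<Rightarrow> ('a \<Rightarrow> 'x \<Rightarrow> real) \<Rightarrow> ('a \<Rightarrow> 'x \<Rightarrow> real)" where
  "g_op A ip F H v = (\<lambda>a\<in>A. \<lambda>x\<in>ob F a.
     exp_ext (- H a x + ereal (iprod (lin ip F a) (v a) (\<lambda>z\<in>ob F a. indicator {x} z)) - 1))"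

definition Delta_MP ::
  "'a::order set \<Rightarrow> ('a, 'x) scalar_products \<Rightarrow> ('a, 'x) presheaf \<Rightarrow> ('a \<Rightarrow> 'x \<Rightarrow> ereal)
    \<Rightarrow> ('a \<times> 'a \<Rightarrow> 'x \<Rightarrow> real) \<Rightarrow> ('a \<times> 'a \<Rightarrow> 'x \<Rightarrow> real)" where
  "Delta_MP A ip F H l = delta_op A ip F (g_op A ip F H (zeta_op A ip F (d_op A ip F l)))"

definition MP_obj ::
  "'a::order set \<Rightarrow> ('a, 'x) scalar_products \<Rightarrow> ('a, 'x) presheaf
    \<Rightarrow> ('a \<times> 'a \<Rightarrow> 'x \<Rightarrow> real, 'a \<Rightarrow> 'x \<Rightarrow> ereal) mpa" where
  "MP_obj A ip F =
     \<lparr>hilb = messages A ip F,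
      par = hamiltonians A F,
      act = (\<lambda>(l, H)\<in>carrier (messages A ip F) \<times> topspace (hamiltonians A F).
               Delta_MP A ip F H l)\<rparr>"

definition phi_one ::
  "'a::order set \<Rightarrow> ('a, 'x) scalar_products \<Rightarrow> ('a, 'x) presheaf \<Rightarrow> ('a, 'x) presheaf
    \<Rightarrow> ('a \<Rightarrow> 'x \<Rightarrow> 'x) \<Rightarrow> ('a \<times> 'a \<Rightarrow> 'x \<Rightarrow> real) \<Rightarrow> ('a \<times> 'a \<Rightarrow> 'x \<Rightarrow> real)" where
  "phi_one A ip F G \<phi> = (\<lambda>v\<in>carrier (messages A ip F).
     \<lambda>(a, b)\<in>below A. pushforward (ob F b) (ob G b) (\<phi> b) (v (a, b)))"

definition psi ::
  "'a set \<Rightarrow> ('a, 'x) presheaf \<Rightarrow> ('a, 'x) presheaf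
    \<Rightarrow> ('a \<Rightarrow> 'x \<Rightarrow> 'x) \<Rightarrow> ('a \<Rightarrow> 'x \<Rightarrow> ereal) \<Rightarrow> ('a \<Rightarrow> 'x \<Rightarrow> ereal)" where
  "psi A F G \<phi> = (\<lambda>H\<in>topspace (hamiltonians A F). \<lambda>a\<in>A. \<lambda>y\<in>ob G a.
     - ln_ext (\<Sum>x\<in>{x \<in> ob F a. \<phi> a x = y}. exp_ext (- H a x)))"

definition MP_arr ::
  "'a::order set \<Rightarrow> ('a, 'x) scalar_products \<Rightarrow> ('a, 'x) presheaf \<Rightarrow> ('a, 'x) presheaf
    \<Rightarrow> ('a \<Rightarrow> 'x \<Rightarrow> 'x)
    \<Rightarrow> (('a \<times> 'a \<Rightarrow> 'x \<Rightarrow> real) \<Rightarrow> ('a \<times> 'a \<Rightarrow> 'x \<Rightarrow> real))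
      \<times> (('a \<Rightarrow> 'x \<Rightarrow> ereal) \<Rightarrow> ('a \<Rightarrow> 'x \<Rightarrow> ereal))" where
  "MP_arr A ip F G \<phi> = (phi_one A ip F G \<phi>, psi A F G \<phi>)"

lemma real_hamiltonians_embedding:
  "embedding_map
     (product_topology (\<lambda>a. product_topology (\<lambda>x. euclideanreal) (ob F a)) A)
     (hamiltonians A F)
     (\<lambda>H. \<lambda>a\<in>A. \<lambda>x\<in>ob F a. ereal (H a x))"
proof -
  let ?R = "UNIV - {\<infinity>, - \<infinity>} :: ereal set"
  let ?X = "product_topology (\<lambda>a. product_topology (\<lambda>x. euclideanreal) (ob F a)) A"
  let ?S = "\<Pi>\<^sub>E a\<in>A. \<Pi>\<^sub>E x\<in>ob F a. ?R"
  let ?Y = "product_topology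
      (\<lambda>a. product_topology (\<lambda>x. subtopology euclidean ?R) (ob F a)) A"
  let ?f = "\<lambda>H. \<lambda>a\<in>A. \<lambda>x\<in>ob F a. ereal (H a x)"
  let ?g = "\<lambda>H. \<lambda>a\<in>A. \<lambda>x\<in>ob F a. real_of_ereal (H a x)"
  have eq: "{h. h \<noteq> - \<infinity>} \<inter> ?R = ?R" by auto
  have Y: "subtopology (hamiltonians A F) ?S = ?Y"
    by (simp add: hamiltonians_def subtopology_product_topology subtopology_subtopology eq)
  have cont_e: "continuous_map euclideanreal (subtopology euclidean ?R) ereal"
    by (auto simp: continuous_map_in_subtopology intro: continuous_on_ereal continuous_on_id)
  have cont_r: "continuous_map (subtopology euclidean ?R) euclideanreal real_of_ereal"
    by (auto intro: continuous_on_real)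
  have proj: "continuous_map (product_topology (\<lambda>a. product_topology (\<lambda>x. T) (ob F a)) A) T
      (\<lambda>H. H a x)" if "a \<in> A" "x \<in> ob F a" for T :: "'c topology" and a x
  proof -
    have "continuous_map (product_topology (\<lambda>a. product_topology (\<lambda>x. T) (ob F a)) A)
        (product_topology (\<lambda>x. T) (ob F a)) (\<lambda>H. H a)"
      by (rule continuous_map_product_projection[OF that(1),
            where X = "\<lambda>a. product_topology (\<lambda>x. T) (ob F a)"])
    moreover have "continuous_map (product_topology (\<lambda>x. T) (ob F a)) T (\<lambda>h. h x)"
      by (rule continuous_map_product_projection[OF that(2), where X = "\<lambda>x. T"])
    ultimately show ?thesis
      by (auto dest: continuous_map_compose simp: o_def)
  qed
  have "continuous_map ?X ?Y ?f"
    using continuous_map_compose[OF proj cont_e]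
    by (auto simp: continuous_map_componentwise o_def)
  moreover have "continuous_map ?Y ?X ?g"
    using continuous_map_compose[OF proj cont_r]
    by (auto simp: continuous_map_componentwise o_def)
  moreover have "\<forall>H\<in>topspace ?X. ?g (?f H) = H"
    by (auto simp: PiE_iff fun_eq_iff restrict_def extensional_def)
  moreover have "\<forall>H\<in>topspace ?Y. ?f (?g H) = H"
  proof
    fix H assume "H \<in> topspace ?Y"
    then have H: "H \<in> ?S" by simp
    have "ereal (real_of_ereal (H a x)) = H a x" if "a \<in> A" "x \<in> ob F a" for a x
    proof -
      have "H a x \<in> ?R" using PiE_mem[OF PiE_mem[OF H that(1)] that(2)] .
      then show ?thesis by (cases "H a x") auto
    qed
    then show "?f (?g H) = H"
      using H by (auto simp: PiE_iff fun_eq_iff restrict_def extensional_def)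
  qed
  ultimately have hm: "homeomorphic_maps ?X ?Y ?f ?g"
    by (auto simp: homeomorphic_maps_def)
  then have "homeomorphic_map ?X ?Y ?f" by (auto simp: homeomorphic_map_maps)
  moreover have "?f ` topspace ?X = ?S"
    using homeomorphic_imp_surjective_map[OF calculation] by (simp)
  ultimately show ?thesis using Y by (simp add: embedding_map_def)
qed

end

theory Submission
  imports Defs
begin

text \<open>Write \<open>\<phi>\<^sub>*\<close> for the pushforward along a natural transformation \<open>\<phi> : F \<rightarrow> G\<close>. Naturality
  gives \<open>\<phi>\<^sub>1 \<circ> \<delta>\<^sub>F = \<delta>\<^sub>G \<circ> \<phi>\<^sub>*\<close>, and passing to adjoints shows that \<open>d\<close> and \<open>\<zeta>\<close> turn
  \<open>\<phi>\<^sub>1\<^sup>\<dagger>\<close> into the componentwise adjoint of \<open>\<phi>\<^sub>*\<close>. It remains to move \<open>\<phi>\<^sub>*\<close> through the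
  nonlinear map \<open>g\<close>: as \<open>\<phi>\<^sub>*\<close> sends the indicator of \<open>x\<close> to that of \<open>\<phi> x\<close>, the factor
  \<open>exp (\<langle>v, 1\<^sub>y\<rangle> - 1)\<close> is constant on the fibre over \<open>y\<close>, and summing the weights
  \<open>exp (- H x)\<close> over this fibre gives \<open>exp (- \<psi>(H) y)\<close>. Functoriality of \<open>\<psi>\<close> is the same
  iterated summation over fibres.\<close>

section \<open>Inner product spaces on a carrier set\<close>

text \<open>The vector spaces vary with the presheaf, so they are carrier sets rather than types,
  and Hilbert space theory is set up on carriers. Adjoints are definite descriptions and say nothing
  until existence is known. Composition in MPA needs the adjoint of a composite for arbitrary
  objects, possibly infinite dimensional; this is why Riesz representation is proved in full
  generality. The scalar products on the linearizations are arbitrary, and different presheaves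
  carry unrelated ones. Completeness and boundedness must therefore come from comparing the norm
  with coordinates, and nothing about \<open>pull\<close> is available beyond its adjunction with
  \<open>push\<close>. The formula for \<open>psi\<close> is a pushforward of measures in disguise:
  on the Boltzmann weights \<open>exp (- H)\<close> it is linear. A point without preimage receives
  weight 0, that is energy \<infinity>. As such a Hamiltonian must again be an admissible argument
  for the next arrow, \<infinity> belongs to the parameter space from the start, and continuity of
  \<open>psi\<close> is obtained by identifying the extended half line of energies with the half
  line of weights.\<close>

lemma cring_real_ring: "cring real_ring"
proof (rule cringI)
  show "abelian_group real_ring"
    by (rule abelian_groupI) (auto simp: real_ring_def intro: exI[of _ "- x" for x])
  show "comm_monoid real_ring"
    by (rule comm_monoidI) (auto simp: real_ring_def)
qed (auto simp: real_ring_def algebra_simps)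

locale ip_space =
  fixes V :: "'v ip_module" (structure)
  assumes inner_product_space: "inner_product_space V"
begin

sublocale module real_ring V
  using inner_product_space by (simp add: inner_product_space_def)

lemma scale_closed [simp, intro]: "x \<in> carrier V \<Longrightarrow> c \<odot> x \<in> carrier V"
  using smult_closed[of c x] by (simp add: real_ring_def)

lemma iprod_commute: "x \<in> carrier V \<Longrightarrow> y \<in> carrier V \<Longrightarrow> iprod V x y = iprod V y x"
  using inner_product_space by (auto simp: inner_product_space_def)

lemma iprod_add_left [simp]:
  "\<lbrakk>x \<in> carrier V; y \<in> carrier V; z \<in> carrier V\<rbrakk>
    \<Longrightarrow> iprod V (x \<oplus> y) z = iprod V x z + iprod V y z"
  using inner_product_space by (auto simp: inner_product_space_def)

lemma iprod_scale_left [simp]: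
  "\<lbrakk>x \<in> carrier V; y \<in> carrier V\<rbrakk> \<Longrightarrow> iprod V (c \<odot> x) y = c * iprod V x y"
  using inner_product_space by (auto simp: inner_product_space_def)

lemma iprod_add_right [simp]:
  "\<lbrakk>x \<in> carrier V; y \<in> carrier V; z \<in> carrier V\<rbrakk>
    \<Longrightarrow> iprod V z (x \<oplus> y) = iprod V z x + iprod V z y"
  using iprod_add_left[of x y z] iprod_commute by (metis add.m_closed)

lemma iprod_scale_right [simp]:
  "\<lbrakk>x \<in> carrier V; y \<in> carrier V\<rbrakk> \<Longrightarrow> iprod V y (c \<odot> x) = c * iprod V y x"
  using iprod_scale_left[of x y c] iprod_commute by (metis scale_closed)

lemma iprod_zero_left [simp]: "x \<in> carrier V \<Longrightarrow> iprod V \<zero> x = 0"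
  using iprod_add_left[of \<zero> \<zero> x] by simp

lemma iprod_zero_right [simp]: "x \<in> carrier V \<Longrightarrow> iprod V x \<zero> = 0"
  using iprod_add_right[of \<zero> \<zero> x] by simp

lemma iprod_minus_left [simp]:
  "\<lbrakk>x \<in> carrier V; y \<in> carrier V\<rbrakk> \<Longrightarrow> iprod V (\<ominus> x) y = - iprod V x y"
  using iprod_add_left[of x "\<ominus> x" y] by (simp add: r_neg)

lemma iprod_minus_right [simp]:
  "\<lbrakk>x \<in> carrier V; y \<in> carrier V\<rbrakk> \<Longrightarrow> iprod V y (\<ominus> x) = - iprod V y x"
  using iprod_add_right[of x "\<ominus> x" y] by (simp add: r_neg)

lemma iprod_diff_left [simp]:
  "\<lbrakk>x \<in> carrier V; y \<in> carrier V; z \<in> carrier V\<rbrakk>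
    \<Longrightarrow> iprod V (x \<ominus> y) z = iprod V x z - iprod V y z"
  by (simp add: a_minus_def)

lemma iprod_diff_right [simp]:
  "\<lbrakk>x \<in> carrier V; y \<in> carrier V; z \<in> carrier V\<rbrakk>
    \<Longrightarrow> iprod V z (x \<ominus> y) = iprod V z x - iprod V z y"
  by (simp add: a_minus_def)

lemma iprod_self_pos: "x \<in> carrier V \<Longrightarrow> x \<noteq> \<zero> \<Longrightarrow> 0 < iprod V x x"
  using inner_product_space by (auto simp: inner_product_space_def)

lemma iprod_self_nonneg [simp]: "x \<in> carrier V \<Longrightarrow> 0 \<le> iprod V x x"
  using iprod_self_pos[of x] by (cases "x = \<zero>") auto

lemma iprod_self_eq_0_iff [simp]: "x \<in> carrier V \<Longrightarrow> iprod V x x = 0 \<longleftrightarrow> x = \<zero>"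
  using iprod_self_pos[of x] by fastforce

lemma diff_eq_zero_iff:
  assumes "x \<in> carrier V" "y \<in> carrier V"
  shows "x \<ominus> y = \<zero> \<longleftrightarrow> x = y"
  using assms by (simp add: a_minus_def) (metis a_inv_closed minus_equality minus_minus r_neg)

text \<open>Nondegeneracy, by testing the difference against itself. It serves as an extensionality
  principle: identities between vectors, in particular between values of adjoints, are checked after
  pairing with an arbitrary vector, where they become identities of real numbers.\<close>

lemma eq_iff_iprod_eq:
  assumes "x \<in> carrier V" "y \<in> carrier V"
    and "\<And>z. z \<in> carrier V \<Longrightarrow> iprod V z x = iprod V z y"
  shows "x = y"
proof -
  have "iprod V (x \<ominus> y) (x \<ominus> y) = 0"
    by (subst iprod_diff_right) (use assms in auto)
  then have "x \<ominus> y = \<zero>"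
    by (subst (asm) iprod_self_eq_0_iff) (use assms in auto)
  then show ?thesis using assms(1,2) diff_eq_zero_iff by simp
qed

section \<open>Norm, Cauchy-Schwarz inequality and metric\<close>

lemma vnorm_nonneg [simp]: "x \<in> carrier V \<Longrightarrow> 0 \<le> vnorm V x"
  by (simp add: vnorm_def)

lemma vnorm_square: "x \<in> carrier V \<Longrightarrow> (vnorm V x)\<^sup>2 = iprod V x x"
  by (simp add: vnorm_def)

lemma Cauchy_Schwarz:
  assumes x: "x \<in> carrier V" and y: "y \<in> carrier V"
  shows "\<bar>iprod V x y\<bar> \<le> vnorm V x * vnorm V y"
proof -
  have "(iprod V x y)\<^sup>2 \<le> iprod V x x * iprod V y y"
  proof (cases "y = \<zero>")
    case False
    then have pos: "0 < iprod V y y" using y iprod_self_pos by simp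
    \<comment> \<open>The coefficient of the orthogonal projection of \<open>x\<close> to the line
      of \<open>y\<close>; it minimises the norm of \<open>x - t y\<close>.\<close>
    define t where "t = iprod V x y / iprod V y y"
    have "0 \<le> iprod V (x \<ominus> t \<odot> y) (x \<ominus> t \<odot> y)"
      by (rule iprod_self_nonneg) (use x y in simp)
    also have "\<dots> = iprod V x x - 2 * t * iprod V x y + t * (t * iprod V y y)"
      using x y by (simp add: iprod_commute[OF y x] algebra_simps)
    also have "t * iprod V y y = iprod V x y" using pos by (simp add: t_def)
    finally have "t * iprod V x y \<le> iprod V x x" by simp
    then show ?thesis using pos by (simp add: t_def field_simps power2_eq_square)
  qed (use x in simp)
  also have "\<dots> = (vnorm V x * vnorm V y)\<^sup>2"
    using x y by (simp add: power_mult_distrib vnorm_square)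
  finally show ?thesis
    using x y by (metis abs_le_square_iff abs_of_nonneg mult_nonneg_nonneg vnorm_nonneg)
qed

lemma vnorm_add_le:
  assumes x: "x \<in> carrier V" and y: "y \<in> carrier V"
  shows "vnorm V (x \<oplus> y) \<le> vnorm V x + vnorm V y"
proof (rule power2_le_imp_le)
  have "(vnorm V (x \<oplus> y))\<^sup>2 = iprod V x x + 2 * iprod V x y + iprod V y y"
    using x y iprod_commute[of y x] by (simp add: vnorm_square)
  also have "\<dots> \<le> (vnorm V x)\<^sup>2 + 2 * (vnorm V x * vnorm V y) + (vnorm V y)\<^sup>2"
    using Cauchy_Schwarz[OF x y] x y by (simp add: vnorm_square)
  finally show "(vnorm V (x \<oplus> y))\<^sup>2 \<le> (vnorm V x + vnorm V y)\<^sup>2"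
    by (simp add: power2_sum)
qed (use x y in simp)

text \<open>The metric that gives meaning to \<open>mcomplete\<close> in the definition of
  \<open>hilbert_space\<close>.\<close>

sublocale Metric_space "carrier V" "vdist V"
proof
  fix x y z
  show "0 \<le> vdist V x y" by (simp add: vdist_def)
  have "vnorm V (x \<ominus> y) = vnorm V (y \<ominus> x)" if "x \<in> carrier V" "y \<in> carrier V"
    using that iprod_commute[of y x] by (simp add: vnorm_def)
  then show "vdist V x y = vdist V y x" by (simp add: vdist_def)
  \<comment> \<open>The rules expanding a difference inside \<open>iprod\<close> are disabled, so
    that \<open>iprod_self_eq_0_iff\<close> still sees the pairing of \<open>x \<ominus> y\<close>
    with itself.\<close>
  show "vdist V x y = 0 \<longleftrightarrow> x = y" if "x \<in> carrier V" "y \<in> carrier V"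
    using that by (simp add: vdist_def vnorm_def diff_eq_zero_iff del: iprod_diff_left iprod_diff_right)
  show "vdist V x z \<le> vdist V x y + vdist V y z"
    if "x \<in> carrier V" "y \<in> carrier V" "z \<in> carrier V"
  proof -
    have "(x \<ominus> y) \<oplus> (y \<ominus> z) = x \<ominus> z"
      by (rule eq_iff_iprod_eq) (use that in simp_all)
    then show ?thesis using that vnorm_add_le[of "x \<ominus> y" "y \<ominus> z"] by (simp add: vdist_def)
  qed
qed

lemma vdist_eq: "x \<in> carrier V \<Longrightarrow> y \<in> carrier V \<Longrightarrow> vdist V x y = vnorm V (x \<ominus> y)"
  by (simp add: vdist_def)

lemma finsum_iprod_right:
  assumes "finite I" "\<And>i. i \<in> I \<Longrightarrow> f i \<in> carrier V" "x \<in> carrier V"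
  shows "iprod V x (\<Oplus>i\<in>I. f i) = (\<Sum>i\<in>I. iprod V x (f i))"
  using assms
proof (induction I)
  case (insert i I)
  have "(\<Oplus>i\<in>insert i I. f i) = f i \<oplus> (\<Oplus>i\<in>I. f i)"
    by (rule finsum_insert) (use insert in auto)
  then show ?case using insert by simp
qed simp

end

locale hilb_space = ip_space +
  assumes mcomplete: "mcomplete"

lemma hilb_space_iff: "hilb_space V \<longleftrightarrow> hilbert_space V"
  by (auto simp: hilb_space_def hilb_space_axioms_def ip_space_def hilbert_space_def)

section \<open>The Riesz representation theorem\<close>

text \<open>The representing vector of \<open>f\<close> minimises \<open>J x = |x|\<^sup>2 / 2 - f x\<close>: by the parallelogram
  law minimising sequences are Cauchy, and the first variation of \<open>J\<close> vanishes at the limit.\<close>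

lemma (in hilb_space) Riesz:
  assumes add: "\<And>x y. x \<in> carrier V \<Longrightarrow> y \<in> carrier V \<Longrightarrow> f (x \<oplus> y) = f x + f y"
    and scale: "\<And>c x. x \<in> carrier V \<Longrightarrow> f (c \<odot> x) = c * f x"
    and bounded: "\<And>x. x \<in> carrier V \<Longrightarrow> \<bar>f x\<bar> \<le> K * vnorm V x"
  obtains u where "u \<in> carrier V" "\<And>x. x \<in> carrier V \<Longrightarrow> f x = iprod V x u"
proof -
  define J where "J x = iprod V x x / 2 - f x" for x
  define m where "m = Inf (J ` carrier V)"
  have "- K\<^sup>2 / 2 \<le> J x" if "x \<in> carrier V" for x
  proof -
    \<comment> \<open>Completing the square: \<open>f x\<close> is at most \<open>K\<close> times
      the norm of \<open>x\<close>, and half the squared norm minus this is at least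
      \<open>- K\<^sup>2 / 2\<close>.\<close>
    have "0 \<le> (vnorm V x - K)\<^sup>2" by simp
    then show ?thesis
      using bounded[OF that] that
      by (simp add: J_def power2_diff vnorm_square algebra_simps)
  qed
  then have bdd: "bdd_below (J ` carrier V)" by (rule bdd_belowI2)
  have m_le: "m \<le> J x" if "x \<in> carrier V" for x
    unfolding m_def using that bdd by (simp add: cINF_lower)
  have "\<exists>x\<in>carrier V. J x < m + 1 / Suc n" for n
  proof -
    have "J ` carrier V \<noteq> {}" using zero_closed by blast
    moreover have "m < m + 1 / Suc n" by simp
    ultimately have "\<exists>y\<in>J ` carrier V. y < m + 1 / Suc n"
      unfolding m_def by (rule cInf_lessD)
    then show ?thesis by (rule bexE) (erule imageE, blast)
  qed
  then obtain X where X: "\<And>n. X n \<in> carrier V" "\<And>n. J (X n) < m + 1 / Suc n" by metis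
  \<comment> \<open>The linear terms cancel at the midpoint, and the parallelogram law leaves a
    quarter of the squared distance.\<close>
  have J_mid: "J x + J y - 2 * J ((1/2) \<odot> (x \<oplus> y)) = (vnorm V (x \<ominus> y))\<^sup>2 / 4"
    if "x \<in> carrier V" "y \<in> carrier V" for x y
    using that iprod_commute[of y x]
    by (simp add: J_def add scale vnorm_square) (simp add: field_simps)
  \<comment> \<open>The midpoint of \<open>X i\<close> and \<open>X j\<close> has value at least
    \<open>m\<close>, so it cannot improve on the two values by more than
    \<open>1 / Suc i + 1 / Suc j\<close>.\<close>
  have dist: "(vnorm V (X i \<ominus> X j))\<^sup>2 \<le> 4 * (1 / Suc i + 1 / Suc j)" for i j
    using J_mid[OF X(1) X(1), of i j] X(2)[of i] X(2)[of j]
      m_le[of "(1/2) \<odot> (X i \<oplus> X j)"] X(1) by fastforce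
  have "MCauchy X"
    unfolding MCauchy_def
  proof (intro conjI allI impI)
    fix e :: real assume "0 < e"
    \<comment> \<open>The bound \<open>dist\<close> has the factor 4 and two summands, each at most
      \<open>1 / Suc N\<close> beyond \<open>N\<close>; hence the 8.\<close>
    then obtain N where N: "inverse (real (Suc N)) < e\<^sup>2 / 8"
      using reals_Archimedean[of "e\<^sup>2 / 8"] by auto
    have "vdist V (X i) (X j) < e" if "N \<le> i" "N \<le> j" for i j
    proof (rule power2_less_imp_less)
      have "1 / real (Suc i) \<le> 1 / real (Suc N)" "1 / real (Suc j) \<le> 1 / real (Suc N)"
        using that by (auto intro!: divide_left_mono)
      then have "(vnorm V (X i \<ominus> X j))\<^sup>2 < e\<^sup>2"
        using dist[of i j] N by (simp add: inverse_eq_divide)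
      then show "(vdist V (X i) (X j))\<^sup>2 < e\<^sup>2" using X(1) by (simp add: vdist_def)
    qed (use \<open>0 < e\<close> in simp)
    then show "\<exists>N. \<forall>i j. N \<le> i \<longrightarrow> N \<le> j \<longrightarrow> vdist V (X i) (X j) < e" by blast
  qed (use X(1) in auto)
  then obtain u where u: "limitin mtopology X u sequentially"
    using mcomplete by (auto simp: mcomplete_def)
  then have uV: "u \<in> carrier V" and lim: "(\<lambda>n. vdist V (X n) u) \<longlonglongrightarrow> 0"
    by (auto simp: limitin_metric_dist_null)
  have "f z = iprod V z u" if z: "z \<in> carrier V" for z
  proof -
    \<comment> \<open>The derivative of \<open>J\<close> at \<open>u\<close> in direction
      \<open>z\<close>.\<close>
    define c where "c = iprod V u z - f z"
    have lim_iprod: "(\<lambda>n. iprod V (X n) z) \<longlonglongrightarrow> iprod V u z"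
    proof (rule LIM_zero_cancel, rule Lim_null_comparison)
      show "\<forall>\<^sub>F n in sequentially. norm (iprod V (X n) z - iprod V u z) \<le> vdist V (X n) u * vnorm V z"
        using Cauchy_Schwarz[of "X n \<ominus> u" z for n] X(1) uV z by (simp add: vdist_def)
      show "(\<lambda>n. vdist V (X n) u * vnorm V z) \<longlonglongrightarrow> 0"
        using tendsto_mult_left_zero[OF lim] .
    qed
    \<comment> \<open>The variation is computed at \<open>X n\<close>, where \<open>J\<close> is
      within \<open>1 / Suc n\<close> of its infimum, and only then passed to the limit. This avoids
      evaluating \<open>J\<close> at \<open>u\<close>.\<close>
    have var: "0 \<le> t * c + t\<^sup>2 * (iprod V z z / 2)" for t
    proof -
      have "- (1 / Suc n) \<le> t * (iprod V (X n) z - f z) + t\<^sup>2 * (iprod V z z / 2)" for n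
      proof -
        have "J (X n \<oplus> t \<odot> z) = J (X n) + t * (iprod V (X n) z - f z) + t\<^sup>2 * (iprod V z z / 2)"
          using X(1) z iprod_commute[of z "X n"]
          by (simp add: J_def add scale) (simp add: field_simps power2_eq_square)
        then show ?thesis using m_le[of "X n \<oplus> t \<odot> z"] X(2)[of n] X(1) z by simp
      qed
      moreover have "(\<lambda>n. - (1 / Suc n)) \<longlonglongrightarrow> - 0"
        by (intro tendsto_minus) (use LIMSEQ_inverse_real_of_nat in \<open>simp add: inverse_eq_divide\<close>)
      moreover have "(\<lambda>n. t * (iprod V (X n) z - f z) + t\<^sup>2 * (iprod V z z / 2))
          \<longlonglongrightarrow> t * c + t\<^sup>2 * (iprod V z z / 2)"
        unfolding c_def by (intro tendsto_intros lim_iprod)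
      ultimately have "- 0 \<le> t * c + t\<^sup>2 * (iprod V z z / 2)"
        by (intro LIMSEQ_le[of "\<lambda>n. - (1 / Suc n)"]) auto
      then show ?thesis by simp
    qed
    have "c = 0"
    proof (rule ccontr)
      assume "c \<noteq> 0"
      define q where "q = iprod V z z / 2"
      have q: "0 \<le> q" using z by (simp add: q_def)
      \<comment> \<open>The exact minimiser \<open>- c / (2 * q)\<close> fails for
        \<open>q = 0\<close>; the denominator \<open>q + 1\<close> is always positive and still
        makes the quadratic polynomial negative.\<close>
      define t where "t = - c / (q + 1)"
      have "t * c + t\<^sup>2 * q = - (c\<^sup>2 / (q + 1)\<^sup>2)"
        using q by (simp add: t_def power2_eq_square divide_simps) (simp add: algebra_simps)
      moreover have "0 < c\<^sup>2 / (q + 1)\<^sup>2" using q \<open>c \<noteq> 0\<close> by simp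
      ultimately show False using var[of t] unfolding q_def[symmetric] by linarith
    qed
    then show ?thesis using iprod_commute[OF z uV] by (simp add: c_def)
  qed
  with uV show thesis using that by blast
qed

section \<open>Bounded linear maps and adjoints\<close>

lemma bounded_linear_mapD:
  assumes "bounded_linear_map V W f"
  shows bounded_linear_map_closed: "x \<in> carrier V \<Longrightarrow> f x \<in> carrier W"
    and bounded_linear_map_add: "x \<in> carrier V \<Longrightarrow> y \<in> carrier V \<Longrightarrow> f (x \<oplus>\<^bsub>V\<^esub> y) = f x \<oplus>\<^bsub>W\<^esub> f y"
    and bounded_linear_map_scale: "x \<in> carrier V \<Longrightarrow> f (c \<odot>\<^bsub>V\<^esub> x) = c \<odot>\<^bsub>W\<^esub> f x"
  using assms by (auto simp: bounded_linear_map_def)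

text \<open>The definition admits negative constants, which can occur on the zero space. A
  nonnegative one is needed to multiply and compare bounds.\<close>

lemma bounded_linear_map_bound:
  assumes V: "inner_product_space V" and f: "bounded_linear_map V W f"
  obtains K where "0 \<le> K" "\<And>x. x \<in> carrier V \<Longrightarrow> vnorm W (f x) \<le> K * vnorm V x"
proof -
  interpret V: ip_space V using V by (rule ip_space.intro)
  obtain K where K: "\<And>x. x \<in> carrier V \<Longrightarrow> vnorm W (f x) \<le> K * vnorm V x"
    using f unfolding bounded_linear_map_def by blast
  have "vnorm W (f x) \<le> \<bar>K\<bar> * vnorm V x" if "x \<in> carrier V" for x
    using K[OF that] V.vnorm_nonneg[OF that] by (meson abs_ge_self mult_right_mono order_trans)
  then show thesis using that by (meson abs_ge_zero)
qed

text \<open>The definite description is resolved here: nondegeneracy in \<open>V\<close> determines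
  the values on \<open>carrier W\<close>, extensionality those outside. Afterwards an adjoint is
  recognised by its defining identity alone.\<close>

lemma adjoint_eqI:
  assumes V: "inner_product_space V"
    and g: "g \<in> carrier W \<rightarrow>\<^sub>E carrier V"
    and adj: "\<And>x y. x \<in> carrier V \<Longrightarrow> y \<in> carrier W \<Longrightarrow> iprod W (f x) y = iprod V x (g y)"
  shows "adjoint V W f = g"
  unfolding adjoint_def
proof (rule the_equality)
  interpret V: ip_space V using V by (rule ip_space.intro)
  fix h assume h: "h \<in> carrier W \<rightarrow>\<^sub>E carrier V \<and>
     (\<forall>x\<in>carrier V. \<forall>y\<in>carrier W. iprod W (f x) y = iprod V x (h y))"
  show "h = g"
  proof (rule PiE_ext[of h "carrier W" "\<lambda>_. carrier V"])
    fix y assume "y \<in> carrier W"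
    with h g adj show "h y = g y"
      by (intro V.eq_iff_iprod_eq) (auto simp: PiE_iff)
  qed (use h g in auto)
qed (use g adj in auto)

text \<open>For fixed \<open>y\<close> the functional sending \<open>x\<close> to
  \<open>iprod W (f x) y\<close> is bounded, by Cauchy-Schwarz in \<open>W\<close> and the bound of
  \<open>f\<close>; its Riesz vector in \<open>V\<close> is the value of the adjoint at
  \<open>y\<close>.\<close>

lemma adjoint_exists:
  assumes V: "hilbert_space V" and W: "inner_product_space W" and f: "bounded_linear_map V W f"
  shows adjoint_funcset: "adjoint V W f \<in> carrier W \<rightarrow>\<^sub>E carrier V"
    and adjoint_iprod:
      "x \<in> carrier V \<Longrightarrow> y \<in> carrier W \<Longrightarrow> iprod V x (adjoint V W f y) = iprod W (f x) y"
proof -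
  interpret V: hilb_space V using V by (simp add: hilb_space_iff)
  interpret W: ip_space W using W by (rule ip_space.intro)
  note fD = bounded_linear_mapD[OF f]
  obtain K where K: "0 \<le> K" "\<And>x. x \<in> carrier V \<Longrightarrow> vnorm W (f x) \<le> K * vnorm V x"
    using bounded_linear_map_bound[OF V.inner_product_space f] by blast
  have "\<exists>u\<in>carrier V. \<forall>x\<in>carrier V. iprod W (f x) y = iprod V x u" if y: "y \<in> carrier W" for y
  proof -
    have "\<bar>iprod W (f x) y\<bar> \<le> (K * vnorm W y) * vnorm V x" if "x \<in> carrier V" for x
    proof -
      have "\<bar>iprod W (f x) y\<bar> \<le> vnorm W (f x) * vnorm W y"
        using that y by (intro W.Cauchy_Schwarz fD)
      also have "\<dots> \<le> K * vnorm V x * vnorm W y"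
        using K(2)[OF that] y by (intro mult_right_mono) auto
      finally show ?thesis by (simp add: mult_ac)
    qed
    then obtain u where "u \<in> carrier V" "\<And>x. x \<in> carrier V \<Longrightarrow> iprod W (f x) y = iprod V x u"
      by (rule V.Riesz[rotated 2]) (use fD y in auto)
    then show ?thesis by blast
  qed
  then obtain g where g: "\<And>y. y \<in> carrier W \<Longrightarrow> g y \<in> carrier V"
      "\<And>x y. y \<in> carrier W \<Longrightarrow> x \<in> carrier V \<Longrightarrow> iprod W (f x) y = iprod V x (g y)"
    by metis
  have eq: "adjoint V W f = restrict g (carrier W)"
    by (rule adjoint_eqI[OF V.inner_product_space]) (use g in auto)
  show "adjoint V W f \<in> carrier W \<rightarrow>\<^sub>E carrier V" using g(1) by (auto simp: eq)
  show "iprod V x (adjoint V W f y) = iprod W (f x) y" if "x \<in> carrier V" "y \<in> carrier W"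
    using that g(2) by (simp add: eq)
qed

lemma adjoint_closed:
  assumes "hilbert_space V" "inner_product_space W" "bounded_linear_map V W f" "y \<in> carrier W"
  shows "adjoint V W f y \<in> carrier V"
  using adjoint_funcset[OF assms(1-3)] assms(4) by auto

lemma bounded_linear_map_compose:
  assumes U: "inner_product_space U" and V: "inner_product_space V"
    and f: "bounded_linear_map U V f" and g: "bounded_linear_map V W g"
  shows "bounded_linear_map U W (compose (carrier U) g f)"
proof -
  interpret U: ip_space U using U by (rule ip_space.intro)
  note D = bounded_linear_mapD[OF f] bounded_linear_mapD[OF g]
  obtain K where K: "0 \<le> K" "\<And>x. x \<in> carrier U \<Longrightarrow> vnorm V (f x) \<le> K * vnorm U x"
    using bounded_linear_map_bound[OF U f] by blast
  obtain L where L: "0 \<le> L" "\<And>x. x \<in> carrier V \<Longrightarrow> vnorm W (g x) \<le> L * vnorm V x"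
    using bounded_linear_map_bound[OF V g] by blast
  have "vnorm W (g (f x)) \<le> (L * K) * vnorm U x" if "x \<in> carrier U" for x
    using L(2)[OF D(1)[OF that]] mult_left_mono[OF K(2)[OF that] L(1)] by simp
  then show ?thesis
    using D by (auto simp: bounded_linear_map_def compose_def intro!: exI[of _ "L * K"])
qed

lemma adjoint_compose:
  assumes U: "hilbert_space U" and V: "hilbert_space V" and W: "inner_product_space W"
    and f: "bounded_linear_map U V f" and g: "bounded_linear_map V W g"
  shows "adjoint U W (compose (carrier U) g f)
    = compose (carrier W) (adjoint U V f) (adjoint V W g)"
proof -
  have ip: "inner_product_space U" "inner_product_space V"
    using U V by (auto simp: hilbert_space_def)
  note closed = adjoint_closed[OF U ip(2) f] adjoint_closed[OF V W g]
    bounded_linear_map_closed[OF f]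
  show ?thesis
  proof (rule adjoint_eqI[OF ip(1)])
    fix x y assume "x \<in> carrier U" "y \<in> carrier W"
    then show "iprod W (compose (carrier U) g f x) y
        = iprod U x (compose (carrier W) (adjoint U V f) (adjoint V W g) y)"
      by (simp add: compose_def adjoint_iprod[OF U ip(2) f] adjoint_iprod[OF V W g] closed)
  qed (auto simp: compose_def closed)
qed

lemma bounded_linear_map_id:
  assumes "inner_product_space V"
  shows "bounded_linear_map V V (\<lambda>x\<in>carrier V. x)"
proof -
  interpret ip_space V using assms by (rule ip_space.intro)
  show ?thesis by (auto simp: bounded_linear_map_def intro!: exI[of _ 1])
qed

lemma adjoint_id:
  assumes "inner_product_space V"
  shows "adjoint V V (\<lambda>x\<in>carrier V. x) = (\<lambda>x\<in>carrier V. x)"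
  by (rule adjoint_eqI[OF assms]) auto

text \<open>Differences and finite sums are the two operations from which \<open>d_op\<close> and
  \<open>zeta_op\<close> are built, so linearity of the adjoint is recorded in exactly these
  forms.\<close>

lemma adjoint_diff:
  assumes V: "hilbert_space V" and W: "inner_product_space W" and f: "bounded_linear_map V W f"
    and "y \<in> carrier W" "z \<in> carrier W"
  shows "adjoint V W f (y \<ominus>\<^bsub>W\<^esub> z) = adjoint V W f y \<ominus>\<^bsub>V\<^esub> adjoint V W f z"
proof -
  interpret V: hilb_space V using V by (simp add: hilb_space_iff)
  interpret W: ip_space W using W by (rule ip_space.intro)
  show ?thesis
    by (rule V.eq_iff_iprod_eq)
      (use assms in \<open>simp_all add: adjoint_closed adjoint_iprod bounded_linear_map_closed\<close>)
qed

lemma adjoint_finsum: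
  assumes V: "hilbert_space V" and W: "inner_product_space W" and f: "bounded_linear_map V W f"
    and I: "finite I" "\<And>i. i \<in> I \<Longrightarrow> g i \<in> carrier W"
  shows "adjoint V W f (\<Oplus>\<^bsub>W\<^esub>i\<in>I. g i) = (\<Oplus>\<^bsub>V\<^esub>i\<in>I. adjoint V W f (g i))"
proof -
  interpret V: hilb_space V using V by (simp add: hilb_space_iff)
  interpret W: ip_space W using W by (rule ip_space.intro)
  have closed: "adjoint V W f (g i) \<in> carrier V" if "i \<in> I" for i
    using that I(2) by (intro adjoint_closed V W f)
  have sum_closed: "(\<Oplus>\<^bsub>W\<^esub>i\<in>I. g i) \<in> carrier W" using I(2) by auto
  show ?thesis
  proof (rule V.eq_iff_iprod_eq)
    fix x assume x: "x \<in> carrier V"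
    then have "iprod V x (adjoint V W f (\<Oplus>\<^bsub>W\<^esub>i\<in>I. g i)) = (\<Sum>i\<in>I. iprod W (f x) (g i))"
      using I sum_closed
      by (simp add: adjoint_iprod[OF V W f] W.finsum_iprod_right bounded_linear_map_closed[OF f])
    also have "\<dots> = (\<Sum>i\<in>I. iprod V x (adjoint V W f (g i)))"
      using x I(2) by (intro sum.cong refl) (simp add: adjoint_iprod[OF V W f])
    also have "\<dots> = iprod V x (\<Oplus>\<^bsub>V\<^esub>i\<in>I. adjoint V W f (g i))"
      using x I closed by (simp add: V.finsum_iprod_right)
    finally show "iprod V x (adjoint V W f (\<Oplus>\<^bsub>W\<^esub>i\<in>I. g i))
      = iprod V x (\<Oplus>\<^bsub>V\<^esub>i\<in>I. adjoint V W f (g i))" .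
  qed (use closed sum_closed in \<open>auto intro: adjoint_closed V W f\<close>)
qed

section \<open>The category MPA\<close>

lemma mpa_objD:
  assumes "mpa_obj D"
  shows mpa_obj_hilb: "hilbert_space (hilb D)"
    and mpa_obj_ip: "inner_product_space (hilb D)"
    and mpa_obj_act: "x \<in> carrier (hilb D) \<Longrightarrow> s \<in> topspace (par D) \<Longrightarrow> act D (x, s) \<in> carrier (hilb D)"
  using assms by (auto simp: mpa_obj_def hilbert_space_def)

text \<open>Applying the law of the second morphism and then that of the first produces the two
  adjoints in reversed order, and their composite is the adjoint of the composite.\<close>

lemma mpa_hom_compose:
  assumes D: "mpa_obj D0" "mpa_obj D1" "mpa_obj D2"
    and f: "(\<alpha>, \<beta>) \<in> mpa_hom D0 D1" and g: "(\<alpha>', \<beta>') \<in> mpa_hom D1 D2"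
  shows "(compose (carrier (hilb D0)) \<alpha>' \<alpha>, compose (topspace (par D0)) \<beta>' \<beta>) \<in> mpa_hom D0 D2"
proof -
  have \<alpha>: "bounded_linear_map (hilb D0) (hilb D1) \<alpha>"
    and \<alpha>': "bounded_linear_map (hilb D1) (hilb D2) \<alpha>'"
    and \<beta>: "continuous_map (par D0) (par D1) \<beta>" and \<beta>': "continuous_map (par D1) (par D2) \<beta>'"
    and act1: "\<And>x s. x \<in> carrier (hilb D1) \<Longrightarrow> s \<in> topspace (par D0) \<Longrightarrow>
      act D1 (x, \<beta> s) = \<alpha> (act D0 (adjoint (hilb D0) (hilb D1) \<alpha> x, s))"
    and act2: "\<And>x s. x \<in> carrier (hilb D2) \<Longrightarrow> s \<in> topspace (par D1) \<Longrightarrow>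
      act D2 (x, \<beta>' s) = \<alpha>' (act D1 (adjoint (hilb D1) (hilb D2) \<alpha>' x, s))"
    using f g by (auto simp: mpa_hom_def)
  note adj = adjoint_closed[OF mpa_obj_hilb[OF D(1)] mpa_obj_ip[OF D(2)] \<alpha>]
    adjoint_closed[OF mpa_obj_hilb[OF D(2)] mpa_obj_ip[OF D(3)] \<alpha>']
  have \<beta>_closed: "\<beta> s \<in> topspace (par D1)" if "s \<in> topspace (par D0)" for s
    using \<beta> that by (auto simp: continuous_map_def)
  have "continuous_map (par D0) (par D2) (compose (topspace (par D0)) \<beta>' \<beta>)"
    by (rule continuous_map_eq[OF continuous_map_compose[OF \<beta> \<beta>']]) (simp add: compose_def)
  moreover have "act D2 (x, \<beta>' (\<beta> s))
      = \<alpha>' (\<alpha> (act D0 (adjoint (hilb D0) (hilb D2) (compose (carrier (hilb D0)) \<alpha>' \<alpha>) x, s)))"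
    if "x \<in> carrier (hilb D2)" "s \<in> topspace (par D0)" for x s
    using that \<beta>_closed adj
    by (simp add: act1 act2 compose_eq
        adjoint_compose[OF mpa_obj_hilb mpa_obj_hilb mpa_obj_ip \<alpha> \<alpha>', OF D])
  \<comment> \<open>The extensional composite equals \<open>\<alpha>'\<close> after
    \<open>\<alpha>\<close> only on the carrier; this places the argument of \<open>act D0\<close>,
    and hence its value, there.\<close>
  moreover have "adjoint (hilb D0) (hilb D2) (compose (carrier (hilb D0)) \<alpha>' \<alpha>) x \<in> carrier (hilb D0)"
    if "x \<in> carrier (hilb D2)" for x
    by (rule adjoint_closed[OF mpa_obj_hilb mpa_obj_ip
          bounded_linear_map_compose[OF mpa_obj_ip mpa_obj_ip \<alpha> \<alpha>'], OF D(1,3,1,2) that])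
  ultimately show ?thesis
    using bounded_linear_map_compose[OF mpa_obj_ip mpa_obj_ip \<alpha> \<alpha>', OF D(1,2)]
    by (auto simp: mpa_hom_def compose_eq mpa_obj_act[OF D(1)])
qed

lemma category_MPA: "category MPA"
proof
  fix D :: "('v, 's) mpa" assume "D \<in> Obj MPA"
  then show "Ident MPA D \<in> Hom MPA D D"
    by (auto simp: MPA_def mpa_hom_def mpa_obj_act bounded_linear_map_id mpa_obj_ip adjoint_id
        intro: continuous_map_eq[OF continuous_map_id])
next
  fix D0 D1 D2 :: "('v, 's) mpa" and f g
  assume "D0 \<in> Obj MPA" "D1 \<in> Obj MPA" "D2 \<in> Obj MPA" "f \<in> Hom MPA D0 D1" "g \<in> Hom MPA D1 D2"
  then show "Comp MPA D0 D1 D2 g f \<in> Hom MPA D0 D2"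
    by (cases f; cases g) (simp add: MPA_def mpa_hom_compose)
next
  fix D0 D1 :: "('v, 's) mpa" and f assume "f \<in> Hom MPA D0 D1"
  moreover obtain \<alpha> \<beta> where "f = (\<alpha>, \<beta>)" by fastforce
  \<comment> \<open>The unit laws hold as equalities of functions because both components are
    extensional.\<close>
  ultimately have *: "f = (\<alpha>, \<beta>)" "\<alpha> \<in> carrier (hilb D0) \<rightarrow>\<^sub>E carrier (hilb D1)"
    "\<beta> \<in> topspace (par D0) \<rightarrow>\<^sub>E topspace (par D1)"
    by (auto simp: MPA_def mpa_hom_def bounded_linear_map_def continuous_map_def PiE_def)
  show "Comp MPA D0 D0 D1 f (Ident MPA D0) = f"
    using * by (auto simp: MPA_def compose_def fun_eq_iff PiE_iff extensional_def)
  show "Comp MPA D0 D1 D1 (Ident MPA D1) f = f"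
    using * by (auto simp: MPA_def compose_def fun_eq_iff PiE_iff extensional_def)
next
  fix D0 D1 D2 D3 :: "('v, 's) mpa" and f g h
  assume "f \<in> Hom MPA D0 D1" "g \<in> Hom MPA D1 D2" "h \<in> Hom MPA D2 D3"
  then show "Comp MPA D0 D2 D3 h (Comp MPA D0 D1 D2 g f) = Comp MPA D0 D1 D3 (Comp MPA D1 D2 D3 h g) f"
    by (cases f; cases g; cases h)
      (auto simp: MPA_def mpa_hom_def bounded_linear_map_def continuous_map_def compose_def fun_eq_iff)
qed

section \<open>Finite direct sums\<close>

lemma direct_sum_simps [simp]:
  "carrier (direct_sum I V) = (\<Pi>\<^sub>E i\<in>I. carrier (V i))"
  "\<zero>\<^bsub>direct_sum I V\<^esub> = (\<lambda>i\<in>I. \<zero>\<^bsub>V i\<^esub>)"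
  "f \<oplus>\<^bsub>direct_sum I V\<^esub> g = (\<lambda>i\<in>I. f i \<oplus>\<^bsub>V i\<^esub> g i)"
  "c \<odot>\<^bsub>direct_sum I V\<^esub> f = (\<lambda>i\<in>I. c \<odot>\<^bsub>V i\<^esub> f i)"
  "iprod (direct_sum I V) f g = (\<Sum>i\<in>I. iprod (V i) (f i) (g i))"
  by (simp_all add: direct_sum_def)

lemma inner_product_space_direct_sum:
  assumes I: "finite I" and V: "\<And>i. i \<in> I \<Longrightarrow> inner_product_space (V i)"
  shows "inner_product_space (direct_sum I V)"
proof -
  have ip: "ip_space (V i)" if "i \<in> I" for i using V[OF that] by (rule ip_space.intro)
  have mod: "Module.module real_ring (V i)" if "i \<in> I" for i
    using V[OF that] by (simp add: inner_product_space_def)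
  have grp: "abelian_group (V i)" if "i \<in> I" for i
    using mod[OF that] by (rule Module.module.axioms(2))
  have mon: "abelian_monoid (V i)" if "i \<in> I" for i
    using grp[OF that] by (rule abelian_group.axioms(1))
  have "abelian_group (direct_sum I V)"
  proof (rule abelian_groupI)
    fix x assume "x \<in> carrier (direct_sum I V)"
    then show "\<exists>y\<in>carrier (direct_sum I V). y \<oplus>\<^bsub>direct_sum I V\<^esub> x = \<zero>\<^bsub>direct_sum I V\<^esub>"
      by (intro bexI[of _ "\<lambda>i\<in>I. \<ominus>\<^bsub>V i\<^esub> x i"])
        (auto simp: PiE_iff fun_eq_iff abelian_group.l_neg[OF grp] intro: abelian_group.a_inv_closed[OF grp])
  qed (auto simp: PiE_iff fun_eq_iff restrict_def extensional_def
      abelian_monoid.a_assoc[OF mon]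
      abelian_monoid.l_zero[OF mon] abelian_monoid.zero_closed[OF mon] abelian_monoid.a_closed[OF mon]
      intro: abelian_monoid.a_comm[OF mon])
  then have "Module.module real_ring (direct_sum I V)"
  proof (rule Module.moduleI[OF cring_real_ring])
  qed (auto simp: PiE_iff fun_eq_iff restrict_def extensional_def
      Module.module.smult_closed[OF mod] Module.module.smult_one[OF mod]
      Module.module.smult_l_distr[OF mod] Module.module.smult_r_distr[OF mod]
      Module.module.smult_assoc1[OF mod])
  moreover have "0 < (\<Sum>i\<in>I. iprod (V i) (x i) (x i))"
    if x: "x \<in> (\<Pi>\<^sub>E i\<in>I. carrier (V i))" and ne: "x \<noteq> (\<lambda>i\<in>I. \<zero>\<^bsub>V i\<^esub>)" for x
  proof -
    obtain i where i: "i \<in> I" "x i \<noteq> \<zero>\<^bsub>V i\<^esub>"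
      using x ne by (auto simp: fun_eq_iff PiE_iff extensional_def restrict_def split: if_splits)
    show ?thesis
      by (rule sum_pos2[OF I i(1)])
        (use i x in \<open>auto simp: PiE_iff intro: ip_space.iprod_self_pos[OF ip] ip_space.iprod_self_nonneg[OF ip]\<close>)
  qed
  ultimately show ?thesis
    by (auto simp: inner_product_space_def PiE_iff sum.distrib[symmetric] sum_distrib_left
        ip_space.iprod_add_left[OF ip] ip_space.iprod_scale_left[OF ip]
        intro!: sum.cong ip_space.iprod_commute[OF ip])
qed

text \<open>Subtraction is not a field of the record: it is derived from the additive inverse,
  itself a definite description. Its componentwise form therefore comes from uniqueness of inverses
  in each summand.\<close>

lemma direct_sum_diff:
  assumes I: "finite I" and V: "\<And>i. i \<in> I \<Longrightarrow> inner_product_space (V i)"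
    and x: "x \<in> (\<Pi>\<^sub>E i\<in>I. carrier (V i))" and y: "y \<in> (\<Pi>\<^sub>E i\<in>I. carrier (V i))"
  shows "x \<ominus>\<^bsub>direct_sum I V\<^esub> y = (\<lambda>i\<in>I. x i \<ominus>\<^bsub>V i\<^esub> y i)"
proof -
  interpret D: ip_space "direct_sum I V"
    by (rule ip_space.intro) (rule inner_product_space_direct_sum[OF I V])
  have ip: "ip_space (V i)" if "i \<in> I" for i using V[OF that] by (rule ip_space.intro)
  have "(x \<ominus>\<^bsub>direct_sum I V\<^esub> y) i = x i \<ominus>\<^bsub>V i\<^esub> y i" if "i \<in> I" for i
  proof -
    interpret Vi: ip_space "V i" using ip[OF that] .
    have mem: "x i \<in> carrier (V i)" "y i \<in> carrier (V i)" using x y that by auto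
    have z: "\<ominus>\<^bsub>direct_sum I V\<^esub> y \<in> (\<Pi>\<^sub>E i\<in>I. carrier (V i))"
      using D.a_inv_closed[of y] y by simp
    have "(\<ominus>\<^bsub>direct_sum I V\<^esub> y) i \<oplus>\<^bsub>V i\<^esub> y i = \<zero>\<^bsub>V i\<^esub>"
      using D.l_neg[of y] y that by (auto simp: fun_eq_iff dest: spec[of _ i])
    then have "(\<ominus>\<^bsub>direct_sum I V\<^esub> y) i = \<ominus>\<^bsub>V i\<^esub> y i"
      using z that mem(2) by (metis PiE_mem Vi.minus_equality)
    then show ?thesis using that by (simp add: a_minus_def)
  qed
  moreover have "x \<ominus>\<^bsub>direct_sum I V\<^esub> y \<in> (\<Pi>\<^sub>E i\<in>I. carrier (V i))"
    using D.minus_closed[of x y] x y by simp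
  ultimately show ?thesis by (auto simp: fun_eq_iff PiE_iff extensional_def)
qed

text \<open>The squared distance is the sum of the squared distances of the components. Each summand
  is bounded by the total, so the components of a Cauchy sequence are Cauchy; as the index set is
  finite, componentwise limits give back a limit.\<close>

lemma hilbert_space_direct_sum:
  assumes I: "finite I" and V: "\<And>i. i \<in> I \<Longrightarrow> hilbert_space (V i)"
  shows "hilbert_space (direct_sum I V)"
proof -
  have ipV: "inner_product_space (V i)" if "i \<in> I" for i
    using V[OF that] by (simp add: hilbert_space_def)
  interpret D: ip_space "direct_sum I V"
    by (rule ip_space.intro) (rule inner_product_space_direct_sum[OF I ipV])
  have H: "hilb_space (V i)" if "i \<in> I" for i using V[OF that] by (simp add: hilb_space_iff)
  have ip: "ip_space (V i)" if "i \<in> I" for i using ipV[OF that] by (rule ip_space.intro)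
  have dist: "(vdist (direct_sum I V) x y)\<^sup>2 = (\<Sum>i\<in>I. (vdist (V i) (x i) (y i))\<^sup>2)"
    if x: "x \<in> (\<Pi>\<^sub>E i\<in>I. carrier (V i))" and y: "y \<in> (\<Pi>\<^sub>E i\<in>I. carrier (V i))" for x y
  proof -
    have "(vdist (direct_sum I V) x y)\<^sup>2
        = iprod (direct_sum I V) (x \<ominus>\<^bsub>direct_sum I V\<^esub> y) (x \<ominus>\<^bsub>direct_sum I V\<^esub> y)"
      using D.vdist_eq[of x y] D.vnorm_square D.minus_closed[of x y] x y
      by (simp del: D.iprod_diff_left D.iprod_diff_right)
    also have "\<dots> = (\<Sum>i\<in>I. (vdist (V i) (x i) (y i))\<^sup>2)"
    proof -
      have "iprod (V i) (x i \<ominus>\<^bsub>V i\<^esub> y i) (x i \<ominus>\<^bsub>V i\<^esub> y i) = (vdist (V i) (x i) (y i))\<^sup>2" if "i \<in> I" for i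
      proof -
        interpret Vi: ip_space "V i" using ip[OF that] .
        have "x i \<in> carrier (V i)" "y i \<in> carrier (V i)" using x y that by auto
        then show ?thesis
          by (simp add: Vi.vdist_eq Vi.vnorm_square del: Vi.iprod_diff_left Vi.iprod_diff_right)
      qed
      then show ?thesis using direct_sum_diff[OF I ipV x y] by simp
    qed
    finally show ?thesis .
  qed
  have dist_le: "vdist (V i) (x i) (y i) \<le> vdist (direct_sum I V) x y"
    if x: "x \<in> (\<Pi>\<^sub>E i\<in>I. carrier (V i))" and y: "y \<in> (\<Pi>\<^sub>E i\<in>I. carrier (V i))" and i: "i \<in> I" for x y i
  proof (rule power2_le_imp_le)
    show "(vdist (V i) (x i) (y i))\<^sup>2 \<le> (vdist (direct_sum I V) x y)\<^sup>2"
      unfolding dist[OF x y] by (rule member_le_sum) (use i I in auto)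
  qed (rule D.nonneg)
  have "D.mcomplete"
    unfolding D.mcomplete_def
  proof (intro allI impI)
    fix X assume C: "D.MCauchy X"
    then have "range X \<subseteq> carrier (direct_sum I V)" unfolding D.MCauchy_def by (rule conjunct1)
    then have "X n \<in> carrier (direct_sum I V)" for n by (rule range_subsetD)
    then have X: "X n \<in> (\<Pi>\<^sub>E i\<in>I. carrier (V i))" for n unfolding direct_sum_simps .
    have "\<exists>l. l \<in> carrier (V i) \<and> (\<lambda>n. vdist (V i) (X n i) l) \<longlonglongrightarrow> 0" if i: "i \<in> I" for i
    proof -
      interpret Vi: hilb_space "V i" using H[OF i] .
      have "\<exists>N. \<forall>n n'. N \<le> n \<longrightarrow> N \<le> n' \<longrightarrow> vdist (V i) (X n i) (X n' i) < e" if e: "0 < e" for e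
      proof -
        obtain N where "\<And>n n'. N \<le> n \<Longrightarrow> N \<le> n' \<Longrightarrow> vdist (direct_sum I V) (X n) (X n') < e"
          using C[unfolded D.MCauchy_def, THEN conjunct2, rule_format, OF e] by metis
        then have "vdist (V i) (X n i) (X n' i) < e" if "N \<le> n" "N \<le> n'" for n n'
          by (rule le_less_trans[OF dist_le[OF X X i]]) (fact that)+
        then show ?thesis by metis
      qed
      moreover have "X n i \<in> carrier (V i)" for n using X i by auto
      ultimately have "Vi.MCauchy (\<lambda>n. X n i)" by (auto simp: Vi.MCauchy_def)
      then show ?thesis
        using Vi.mcomplete by (auto simp: Vi.mcomplete_def Vi.limitin_metric_dist_null)
    qed
    then obtain l where l: "\<And>i. i \<in> I \<Longrightarrow> l i \<in> carrier (V i)"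
        "\<And>i. i \<in> I \<Longrightarrow> (\<lambda>n. vdist (V i) (X n i) (l i)) \<longlonglongrightarrow> 0"
      by metis
    let ?l = "restrict l I"
    have lV: "?l \<in> (\<Pi>\<^sub>E i\<in>I. carrier (V i))" using l(1) by auto
    have "(\<lambda>n. \<Sum>i\<in>I. (vdist (V i) (X n i) (l i))\<^sup>2) \<longlonglongrightarrow> (\<Sum>i\<in>I. 0\<^sup>2)"
      by (intro tendsto_sum tendsto_power l(2))
    then have "(\<lambda>n. (vdist (direct_sum I V) (X n) ?l)\<^sup>2) \<longlonglongrightarrow> 0"
      by (simp add: dist[OF X lV])
    then have "(\<lambda>n. sqrt ((vdist (direct_sum I V) (X n) ?l)\<^sup>2)) \<longlonglongrightarrow> sqrt 0"
      by (rule tendsto_real_sqrt)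
    then have "(\<lambda>n. vdist (direct_sum I V) (X n) ?l) \<longlonglongrightarrow> 0" by simp
    then have "limitin D.mtopology X ?l sequentially"
      unfolding D.limitin_metric_dist_null using lV X by simp
    then show "\<exists>l. limitin D.mtopology X l sequentially" by blast
  qed
  then show ?thesis using D.inner_product_space by (simp add: hilbert_space_def)
qed

text \<open>Block diagonal operators. \<open>phi_one\<close> is the instance indexed by
  \<open>below A\<close>, so its boundedness and its adjoint can be found block by block.\<close>

definition direct_sum_map ::
  "'i set \<Rightarrow> ('i \<Rightarrow> 'v ip_module) \<Rightarrow> ('i \<Rightarrow> 'v \<Rightarrow> 'w) \<Rightarrow> ('i \<Rightarrow> 'v) \<Rightarrow> 'i \<Rightarrow> 'w" where
  "direct_sum_map I V f = (\<lambda>v\<in>carrier (direct_sum I V). \<lambda>i\<in>I. f i (v i))"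

lemma bounded_linear_map_direct_sum_map:
  assumes I: "finite I" and V: "\<And>i. i \<in> I \<Longrightarrow> inner_product_space (V i)"
    and W: "\<And>i. i \<in> I \<Longrightarrow> inner_product_space (W i)"
    and f: "\<And>i. i \<in> I \<Longrightarrow> bounded_linear_map (V i) (W i) (f i)"
  shows "bounded_linear_map (direct_sum I V) (direct_sum I W) (direct_sum_map I V f)"
proof -
  interpret DV: ip_space "direct_sum I V"
    by (rule ip_space.intro) (rule inner_product_space_direct_sum[OF I V])
  interpret DW: ip_space "direct_sum I W"
    by (rule ip_space.intro) (rule inner_product_space_direct_sum[OF I W])
  note fD = bounded_linear_map_closed[OF f] bounded_linear_map_add[OF f] bounded_linear_map_scale[OF f]
  have "\<exists>K. 0 \<le> K \<and> (\<forall>x\<in>carrier (V i). vnorm (W i) (f i x) \<le> K * vnorm (V i) x)" if "i \<in> I" for i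
    by (rule bounded_linear_map_bound[OF V f, OF that that]) metis
  then obtain K where K: "\<And>i. i \<in> I \<Longrightarrow> 0 \<le> K i"
      "\<And>i x. i \<in> I \<Longrightarrow> x \<in> carrier (V i) \<Longrightarrow> vnorm (W i) (f i x) \<le> K i * vnorm (V i) x"
    by metis
  have closed: "direct_sum_map I V f v \<in> carrier (direct_sum I W)"
    if "v \<in> carrier (direct_sum I V)" for v
    using that by (auto simp: direct_sum_map_def fD PiE_iff)
  \<comment> \<open>The sum of the nonnegative bounds dominates each of them and, unlike a maximum,
    also makes sense for empty \<open>I\<close>.\<close>
  have "vnorm (direct_sum I W) (direct_sum_map I V f v) \<le> sum K I * vnorm (direct_sum I V) v"
    if v: "v \<in> carrier (direct_sum I V)" for v
  proof (rule power2_le_imp_le)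
    have vi: "v i \<in> carrier (V i)" if "i \<in> I" for i using v that by auto
    have "iprod (W i) (f i (v i)) (f i (v i)) \<le> (sum K I)\<^sup>2 * iprod (V i) (v i) (v i)" if i: "i \<in> I" for i
    proof -
      interpret Vi: ip_space "V i" using V[OF i] by (rule ip_space.intro)
      interpret Wi: ip_space "W i" using W[OF i] by (rule ip_space.intro)
      have "vnorm (W i) (f i (v i)) \<le> K i * vnorm (V i) (v i)" by (rule K(2)[OF i vi[OF i]])
      also have "\<dots> \<le> sum K I * vnorm (V i) (v i)"
        using vi[OF i] K(1) i I by (intro mult_right_mono member_le_sum) auto
      finally have "(vnorm (W i) (f i (v i)))\<^sup>2 \<le> (sum K I * vnorm (V i) (v i))\<^sup>2"
        using vi[OF i] fD(1)[OF i] by (intro power_mono) auto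
      then show ?thesis
        using vi[OF i] fD(1)[OF i]
        by (simp add: power_mult_distrib Vi.vnorm_square Wi.vnorm_square)
    qed
    then have "(\<Sum>i\<in>I. iprod (W i) (f i (v i)) (f i (v i)))
        \<le> (\<Sum>i\<in>I. (sum K I)\<^sup>2 * iprod (V i) (v i) (v i))"
      by (rule sum_mono)
    then show "(vnorm (direct_sum I W) (direct_sum_map I V f v))\<^sup>2
        \<le> (sum K I * vnorm (direct_sum I V) v)\<^sup>2"
      unfolding power_mult_distrib DV.vnorm_square[OF v] DW.vnorm_square[OF closed[OF v]]
      using v by (simp add: direct_sum_map_def sum_distrib_left)
  qed (use v K(1) DV.vnorm_nonneg[OF v] in \<open>auto intro!: mult_nonneg_nonneg sum_nonneg\<close>)
  moreover have "direct_sum_map I V f \<in> carrier (direct_sum I V) \<rightarrow>\<^sub>E carrier (direct_sum I W)"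
    using closed unfolding direct_sum_map_def by (intro PiE_I) auto
  moreover have "direct_sum_map I V f (x \<oplus>\<^bsub>direct_sum I V\<^esub> y)
      = direct_sum_map I V f x \<oplus>\<^bsub>direct_sum I W\<^esub> direct_sum_map I V f y"
    if "x \<in> carrier (direct_sum I V)" "y \<in> carrier (direct_sum I V)" for x y
    using that DV.a_closed[OF that] by (auto simp: direct_sum_map_def fD PiE_iff fun_eq_iff)
  moreover have "direct_sum_map I V f (c \<odot>\<^bsub>direct_sum I V\<^esub> x)
      = c \<odot>\<^bsub>direct_sum I W\<^esub> direct_sum_map I V f x"
    if "x \<in> carrier (direct_sum I V)" for c x
    using that DV.scale_closed[OF that, of c] by (auto simp: direct_sum_map_def fD PiE_iff fun_eq_iff)
  ultimately show ?thesis unfolding bounded_linear_map_def by blast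
qed

lemma adjoint_direct_sum_map:
  assumes I: "finite I" and V: "\<And>i. i \<in> I \<Longrightarrow> hilbert_space (V i)"
    and W: "\<And>i. i \<in> I \<Longrightarrow> inner_product_space (W i)"
    and f: "\<And>i. i \<in> I \<Longrightarrow> bounded_linear_map (V i) (W i) (f i)"
  shows "adjoint (direct_sum I V) (direct_sum I W) (direct_sum_map I V f)
    = direct_sum_map I W (\<lambda>i. adjoint (V i) (W i) (f i))"
proof -
  have ipV: "inner_product_space (V i)" if "i \<in> I" for i
    using V[OF that] by (simp add: hilbert_space_def)
  show ?thesis
  proof (rule adjoint_eqI[OF inner_product_space_direct_sum[OF I ipV]])
    show "direct_sum_map I W (\<lambda>i. adjoint (V i) (W i) (f i))
        \<in> carrier (direct_sum I W) \<rightarrow>\<^sub>E carrier (direct_sum I V)"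
      using adjoint_closed[OF V W f] unfolding direct_sum_map_def
      by (intro PiE_I) (auto simp: PiE_iff)
  next
    fix x y assume "x \<in> carrier (direct_sum I V)" "y \<in> carrier (direct_sum I W)"
    then show "iprod (direct_sum I W) (direct_sum_map I V f x) y
        = iprod (direct_sum I V) x (direct_sum_map I W (\<lambda>i. adjoint (V i) (W i) (f i)) y)"
      by (auto simp: direct_sum_map_def PiE_iff adjoint_iprod[OF V W f] intro!: sum.cong)
  qed
qed

section \<open>Finite-dimensional free spaces\<close>

lemma free_space_simps [simp]:
  "carrier (free_space X p) = X \<rightarrow>\<^sub>E UNIV"
  "\<zero>\<^bsub>free_space X p\<^esub> = (\<lambda>x\<in>X. 0)"
  "f \<oplus>\<^bsub>free_space X p\<^esub> g = (\<lambda>x\<in>X. f x + g x)"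
  "c \<odot>\<^bsub>free_space X p\<^esub> f = (\<lambda>x\<in>X. c * f x)"
  "iprod (free_space X p) = p"
  by (simp_all add: free_space_def)

locale finite_free_space =
  fixes X :: "'x set" and p :: "('x \<Rightarrow> real) \<Rightarrow> ('x \<Rightarrow> real) \<Rightarrow> real"
  assumes finite: "finite X" and ip: "inner_product_space (free_space X p)"
begin

abbreviation V where "V \<equiv> free_space X p"

text \<open>In general not an orthonormal basis for \<open>p\<close>: the numbers
  \<open>p (unit_vec x) (unit_vec y)\<close> form its Gram matrix.\<close>

definition unit_vec :: "'x \<Rightarrow> 'x \<Rightarrow> real" where
  "unit_vec x = (\<lambda>z\<in>X. indicator {x} z)"

sublocale S: ip_space V
  using ip by (rule ip_space.intro)

lemma unit_vec_carrier [simp]: "unit_vec x \<in> X \<rightarrow>\<^sub>E UNIV"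
  by (simp add: unit_vec_def)

lemma uminus_eq: "f \<in> X \<rightarrow>\<^sub>E UNIV \<Longrightarrow> \<ominus>\<^bsub>V\<^esub> f = (\<lambda>x\<in>X. - f x)"
  by (rule S.minus_equality) auto

lemma diff_eq: "\<lbrakk>f \<in> X \<rightarrow>\<^sub>E UNIV; g \<in> X \<rightarrow>\<^sub>E UNIV\<rbrakk> \<Longrightarrow> f \<ominus>\<^bsub>V\<^esub> g = (\<lambda>x\<in>X. f x - g x)"
  by (auto simp: a_minus_def uminus_eq fun_eq_iff)

lemma linear_functional_expansion:
  assumes add: "\<And>x y. x \<in> carrier V \<Longrightarrow> y \<in> carrier V \<Longrightarrow> f (x \<oplus>\<^bsub>V\<^esub> y) = f x + f y"
    and scale: "\<And>c x. x \<in> carrier V \<Longrightarrow> f (c \<odot>\<^bsub>V\<^esub> x) = c * f x"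
    and v: "v \<in> carrier V"
  shows "f v = (\<Sum>x\<in>X. v x * f (unit_vec x))"
proof -
  \<comment> \<open>Truncation of \<open>v\<close> to \<open>S\<close>. Enlarging \<open>S\<close>
    by one point adds one multiple of a unit vector, which allows induction on
    \<open>S\<close>.\<close>
  define cut where "cut S = (\<lambda>x\<in>X. if x \<in> S then v x else 0)" for S
  have cut: "cut S \<in> carrier V" for S by (simp add: cut_def)
  have "f (cut S) = (\<Sum>x\<in>S. v x * f (unit_vec x))" if "finite S" "S \<subseteq> X" for S
    using that
  proof (induction S)
    case empty
    have "cut {} = 0 \<odot>\<^bsub>V\<^esub> cut {}" by (auto simp: cut_def fun_eq_iff)
    then have "f (cut {}) = f (0 \<odot>\<^bsub>V\<^esub> cut {})" by (rule arg_cong)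
    also have "\<dots> = 0 * f (cut {})" by (rule scale[OF cut])
    finally show ?case by simp
  next
    case (insert y S)
    have "cut (insert y S) = (v y \<odot>\<^bsub>V\<^esub> unit_vec y) \<oplus>\<^bsub>V\<^esub> cut S"
      using insert by (auto simp: cut_def fun_eq_iff unit_vec_def indicator_def)
    then have "f (cut (insert y S)) = f ((v y \<odot>\<^bsub>V\<^esub> unit_vec y) \<oplus>\<^bsub>V\<^esub> cut S)"
      by (rule arg_cong)
    also have "\<dots> = f (v y \<odot>\<^bsub>V\<^esub> unit_vec y) + f (cut S)"
      by (rule add[OF _ cut]) simp
    also have "f (v y \<odot>\<^bsub>V\<^esub> unit_vec y) = v y * f (unit_vec y)" by (rule scale) simp
    finally show ?case using insert by simp
  qed
  from this[OF finite] have "f (cut X) = (\<Sum>x\<in>X. v x * f (unit_vec x))" by simp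
  moreover have "cut X = v"
    using v by (auto simp: cut_def fun_eq_iff PiE_iff extensional_def)
  ultimately show ?thesis by simp
qed

text \<open>The scalar product of \<open>W\<close> pulled back along \<open>f\<close> is a quadratic
  form in the coordinates. With \<open>f\<close> the identity this shows that \<open>p\<close> is
  continuous; for general \<open>f\<close> it gives boundedness.\<close>

lemma iprod_linear_expansion:
  assumes W: "inner_product_space W" and f: "\<And>x. x \<in> carrier V \<Longrightarrow> f x \<in> carrier W"
    and add: "\<And>x y. x \<in> carrier V \<Longrightarrow> y \<in> carrier V \<Longrightarrow> f (x \<oplus>\<^bsub>V\<^esub> y) = f x \<oplus>\<^bsub>W\<^esub> f y"
    and scale: "\<And>c x. x \<in> carrier V \<Longrightarrow> f (c \<odot>\<^bsub>V\<^esub> x) = c \<odot>\<^bsub>W\<^esub> f x"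
    and v: "v \<in> carrier V"
  shows "iprod W (f v) (f v)
    = (\<Sum>x\<in>X. \<Sum>y\<in>X. v x * v y * iprod W (f (unit_vec x)) (f (unit_vec y)))"
proof -
  interpret W: ip_space W using W by (rule ip_space.intro)
  have expand: "iprod W (f v) w = (\<Sum>x\<in>X. v x * iprod W (f (unit_vec x)) w)" if "w \<in> carrier W" for w
    by (rule linear_functional_expansion) (use that v in \<open>simp_all only: f add scale W.iprod_add_left W.iprod_scale_left\<close>)
  have "iprod W (f v) (f v) = (\<Sum>x\<in>X. v x * iprod W (f (unit_vec x)) (f v))"
    by (rule expand) (rule f[OF v])
  also have "\<dots> = (\<Sum>x\<in>X. v x * (\<Sum>y\<in>X. v y * iprod W (f (unit_vec x)) (f (unit_vec y))))"
  proof (intro sum.cong refl arg_cong2[where f = "(*)"])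
    fix x
    have u: "f (unit_vec y) \<in> carrier W" for y by (rule f) simp
    have "iprod W (f (unit_vec x)) (f v) = iprod W (f v) (f (unit_vec x))"
      by (rule W.iprod_commute[OF u f[OF v]])
    also have "\<dots> = (\<Sum>y\<in>X. v y * iprod W (f (unit_vec x)) (f (unit_vec y)))"
      unfolding expand[OF u] by (intro sum.cong refl) (metis W.iprod_commute[OF u u])
    finally show "iprod W (f (unit_vec x)) (f v)
      = (\<Sum>y\<in>X. v y * iprod W (f (unit_vec x)) (f (unit_vec y)))" .
  qed
  finally show ?thesis by (simp add: sum_distrib_left mult.assoc)
qed

lemma iprod_expansion:
  "v \<in> carrier V \<Longrightarrow> p v v = (\<Sum>x\<in>X. \<Sum>y\<in>X. v x * v y * p (unit_vec x) (unit_vec y))"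
  using iprod_linear_expansion[OF ip, of "\<lambda>x. x" v] by simp

text \<open>The reason is that \<open>p v v\<close> has a positive minimum on the compact euclidean unit
  sphere.\<close>

lemma coordinate_bound:
  shows "\<exists>C\<ge>0. \<forall>v\<in>carrier V. \<forall>x\<in>X. \<bar>v x\<bar> \<le> C * vnorm V v"
proof (cases "X = {}")
  case True
  then show ?thesis by auto
next
  case False
  let ?T = "product_topology (\<lambda>_::'x. euclideanreal) X"
  let ?n = "\<lambda>v::'x \<Rightarrow> real. \<Sum>x\<in>X. (v x)\<^sup>2"
  have proj: "continuous_map ?T euclideanreal (\<lambda>v. v x)" if "x \<in> X" for x
    using continuous_map_product_projection[OF that, of "\<lambda>_. euclideanreal"] by simp
  \<comment> \<open>The euclidean unit sphere, written as a closed subset of a cube so that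
    compactness of a product of intervals applies.\<close>
  define K where "K = {v \<in> topspace ?T. ?n v \<in> {1}} \<inter> (\<Pi>\<^sub>E x\<in>X. {-1..1})"
  have "continuous_map ?T euclideanreal ?n"
    unfolding power2_eq_square by (intro continuous_map_sum finite continuous_map_real_mult proj)
  then have "closedin ?T {v \<in> topspace ?T. ?n v \<in> {1}}"
    by (rule closedin_continuous_map_preimage) simp
  moreover have "compactin ?T (\<Pi>\<^sub>E x\<in>X. {-1..1})" by (simp add: compactin_PiE)
  ultimately have "compactin ?T K" unfolding K_def by (rule closed_Int_compactin)
  \<comment> \<open>Nothing topological is known about \<open>p\<close>; its continuity on the
    diagonal is read off from the polynomial given by the Gram matrix.\<close>
  moreover have "continuous_map ?T euclideanreal
      (\<lambda>v. \<Sum>x\<in>X. \<Sum>y\<in>X. v x * v y * p (unit_vec x) (unit_vec y))"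
    by (intro continuous_map_sum finite continuous_map_real_mult proj) auto
  moreover have "continuous_map ?T euclideanreal (\<lambda>v. p v v)"
    by (rule continuous_map_eq[OF calculation(2)]) (simp add: iprod_expansion)
  ultimately have "compactin euclideanreal ((\<lambda>v. p v v) ` K)"
    by (blast intro: image_compactin)
  then have "compact ((\<lambda>v. p v v) ` K)" by simp
  moreover obtain x0 where x0: "x0 \<in> X" using False by blast
  have "?n (unit_vec x0) = (\<Sum>x\<in>X. if x = x0 then 1 else 0)"
    by (intro sum.cong) (auto simp: unit_vec_def)
  then have "unit_vec x0 \<in> K"
    using x0 finite by (auto simp: K_def unit_vec_def indicator_def)
  then have "(\<lambda>v. p v v) ` K \<noteq> {}" by blast
  ultimately obtain s where s: "s \<in> K" and min: "\<And>v. v \<in> K \<Longrightarrow> p s s \<le> p v v"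
    using compact_attains_inf[of "(\<lambda>v. p v v) ` K"] by blast
  \<comment> \<open>By homogeneity \<open>p v v\<close> is at least \<open>c\<close> times the
    squared euclidean norm of \<open>v\<close>. That norm bounds every coordinate, whence the
    constant \<open>1 / sqrt c\<close>.\<close>
  define c where "c = p s s"
  have s_mem: "s \<in> carrier V" and s_ne: "s \<noteq> \<zero>\<^bsub>V\<^esub>" using s by (auto simp: K_def)
  have c: "0 < c" using S.iprod_self_pos[OF s_mem s_ne] by (simp add: c_def)
  have bound: "\<bar>v x\<bar> \<le> (1 / sqrt c) * vnorm V v" if v: "v \<in> carrier V" and x: "x \<in> X" for v x
  proof (cases "v = \<zero>\<^bsub>V\<^esub>")
    case True
    then show ?thesis using x c S.vnorm_nonneg[OF v] by simp
  next
    case False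
    then obtain y where y: "y \<in> X" "v y \<noteq> 0"
      using v by (auto simp: fun_eq_iff PiE_iff extensional_def restrict_def split: if_splits)
    have n_pos: "0 < ?n v" by (rule sum_pos2[OF finite y(1)]) (use y in auto)
    define r where "r = sqrt (?n v)"
    have r: "0 < r" "r\<^sup>2 = ?n v" using n_pos by (auto simp: r_def)
    have le_r: "\<bar>v z\<bar> \<le> r" if "z \<in> X" for z
      by (rule power2_le_imp_le) (use that r finite in \<open>auto intro!: member_le_sum[of z X "\<lambda>z. (v z)\<^sup>2"]\<close>)
    let ?w = "(1 / r) \<odot>\<^bsub>V\<^esub> v"
    have "- r \<le> v z" "v z \<le> r" if "z \<in> X" for z
      using le_r[OF that] by linarith+
    then have "?w \<in> K"
      using r n_pos by (auto simp: K_def PiE_iff field_simps power_divide sum_divide_distrib[symmetric])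
    then have "c \<le> p ?w ?w" unfolding c_def by (rule min)
    also have "p ?w ?w = (1 / r) * ((1 / r) * p v v)"
      using S.iprod_scale_left[OF v S.scale_closed[OF v], of "1 / r" "1 / r"]
        S.iprod_scale_right[OF v v, of "1 / r"] by simp
    finally have "c * r\<^sup>2 \<le> p v v" using r(1) by (simp add: field_simps power2_eq_square)
    then have "sqrt c * r \<le> vnorm V v"
      using real_sqrt_le_mono[of "c * r\<^sup>2" "p v v"] r(1) by (simp add: vnorm_def real_sqrt_mult)
    then have "r \<le> (1 / sqrt c) * vnorm V v" using c by (simp add: field_simps)
    then show ?thesis using le_r[OF x] by linarith
  qed
  show ?thesis by (rule exI[of _ "1 / sqrt c"]) (use c bound in auto)
qed

text \<open>\<open>coordinate_bound\<close> makes the coordinates of a Cauchy sequence Cauchy in the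
  reals. Conversely coordinatewise convergence implies convergence for \<open>p\<close>, since the
  distance is the square root of a polynomial in the coordinate differences.\<close>

lemma hilbert: "hilbert_space V"
proof -
  obtain C where C: "0 \<le> C" "\<And>v x. v \<in> carrier V \<Longrightarrow> x \<in> X \<Longrightarrow> \<bar>v x\<bar> \<le> C * vnorm V v"
    using coordinate_bound by metis
  have "S.mcomplete"
    unfolding S.mcomplete_def
  proof (intro allI impI)
    fix s assume Cauchy: "S.MCauchy s"
    then have "range s \<subseteq> carrier V" unfolding S.MCauchy_def by (rule conjunct1)
    then have s: "s n \<in> carrier V" for n by (rule range_subsetD)
    have "\<exists>l. (\<lambda>n. s n x) \<longlonglongrightarrow> l" if x: "x \<in> X" for x
    proof -
      have "Cauchy (\<lambda>n. s n x)"
      proof (rule metric_CauchyI)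
        fix e :: real assume e: "0 < e"
        \<comment> \<open>\<open>C\<close> may be 0, hence the division by
          \<open>C + 1\<close>.\<close>
        then have "0 < e / (C + 1)" using C(1) by simp
        then obtain N where N: "\<And>m n. N \<le> m \<Longrightarrow> N \<le> n \<Longrightarrow> vdist V (s m) (s n) < e / (C + 1)"
          using Cauchy[unfolded S.MCauchy_def, THEN conjunct2, rule_format] by metis
        have "dist (s m x) (s n x) < e" if "N \<le> m" "N \<le> n" for m n
        proof -
          have "\<bar>(s m \<ominus>\<^bsub>V\<^esub> s n) x\<bar> \<le> C * vnorm V (s m \<ominus>\<^bsub>V\<^esub> s n)"
            by (rule C(2)[OF S.minus_closed[OF s s] x])
          then have "dist (s m x) (s n x) \<le> C * vdist V (s m) (s n)"
            using x s diff_eq by (simp add: S.vdist_eq[OF s s] dist_real_def)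
          also have "\<dots> \<le> (C + 1) * vdist V (s m) (s n)"
            by (rule mult_right_mono) (rule order.trans[OF _ order.refl], simp, rule S.nonneg)
          also have "\<dots> < e" using N[OF that] C(1) by (simp add: field_simps)
          finally show ?thesis .
        qed
        then show "\<exists>N. \<forall>m\<ge>N. \<forall>n\<ge>N. dist (s m x) (s n x) < e" by metis
      qed
      then show ?thesis by (simp add: Cauchy_convergent_iff convergent_def)
    qed
    then obtain l where l: "\<And>x. x \<in> X \<Longrightarrow> (\<lambda>n. s n x) \<longlonglongrightarrow> l x" by metis
    let ?l = "restrict l X"
    have l_mem: "?l \<in> carrier V" by simp
    have dist: "vdist V (s n) ?l = sqrt (\<Sum>x\<in>X. \<Sum>y\<in>X.
        (s n x - l x) * (s n y - l y) * p (unit_vec x) (unit_vec y))" for n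
      using iprod_expansion[OF S.minus_closed[OF s l_mem], of n] diff_eq[of "s n" ?l] s l_mem
      by (simp add: S.vdist_eq[OF s l_mem] vnorm_def)
    have "(\<lambda>n. vdist V (s n) ?l) \<longlonglongrightarrow> sqrt (\<Sum>x\<in>X. \<Sum>y\<in>X.
        (l x - l x) * (l y - l y) * p (unit_vec x) (unit_vec y))"
      unfolding dist by (intro tendsto_intros l)
    then have "limitin S.mtopology s ?l sequentially"
      unfolding S.limitin_metric_dist_null using s by simp
    then show "\<exists>l. limitin S.mtopology s l sequentially" by blast
  qed
  then show ?thesis using ip by (simp add: hilbert_space_def)
qed

text \<open>Linearity suffices on a finite-dimensional source: in the expansion of the squared norm
  of \<open>f v\<close> each coordinate is at most \<open>C * vnorm V v\<close>, and the remaining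
  factor is the sum \<open>B\<close> of the absolute values of the pulled-back Gram matrix.\<close>

lemma bounded_linear_mapI:
  assumes W: "inner_product_space W" and f: "f \<in> carrier V \<rightarrow>\<^sub>E carrier W"
    and add: "\<And>x y. x \<in> carrier V \<Longrightarrow> y \<in> carrier V \<Longrightarrow> f (x \<oplus>\<^bsub>V\<^esub> y) = f x \<oplus>\<^bsub>W\<^esub> f y"
    and scale: "\<And>c x. x \<in> carrier V \<Longrightarrow> f (c \<odot>\<^bsub>V\<^esub> x) = c \<odot>\<^bsub>W\<^esub> f x"
  shows "bounded_linear_map V W f"
proof -
  interpret W: ip_space W using W by (rule ip_space.intro)
  obtain C where C: "0 \<le> C" "\<And>v x. v \<in> carrier V \<Longrightarrow> x \<in> X \<Longrightarrow> \<bar>v x\<bar> \<le> C * vnorm V v"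
    using coordinate_bound by metis
  define B where "B = (\<Sum>x\<in>X. \<Sum>y\<in>X. \<bar>iprod W (f (unit_vec x)) (f (unit_vec y))\<bar>)"
  have B: "0 \<le> B" by (simp add: B_def sum_nonneg)
  have f': "f x \<in> carrier W" if "x \<in> carrier V" for x using f that by (rule PiE_mem)
  have "vnorm W (f v) \<le> (C * sqrt B) * vnorm V v" if v: "v \<in> carrier V" for v
  proof (rule power2_le_imp_le)
    have "(vnorm W (f v))\<^sup>2
        = (\<Sum>x\<in>X. \<Sum>y\<in>X. v x * v y * iprod W (f (unit_vec x)) (f (unit_vec y)))"
      unfolding W.vnorm_square[OF f'[OF v]] by (rule iprod_linear_expansion[OF W f' add scale v])
    also have "\<dots> \<le> (\<Sum>x\<in>X. \<Sum>y\<in>X.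
        (C * vnorm V v)\<^sup>2 * \<bar>iprod W (f (unit_vec x)) (f (unit_vec y))\<bar>)"
    proof (intro sum_mono)
      fix x y assume "x \<in> X" "y \<in> X"
      then have "\<bar>v x * v y\<bar> \<le> (C * vnorm V v)\<^sup>2"
        unfolding abs_mult power2_eq_square
        using C(2)[OF v] C(1) S.vnorm_nonneg[OF v] by (intro mult_mono) auto
      then have "\<bar>v x * v y * iprod W (f (unit_vec x)) (f (unit_vec y))\<bar>
          \<le> (C * vnorm V v)\<^sup>2 * \<bar>iprod W (f (unit_vec x)) (f (unit_vec y))\<bar>"
        unfolding abs_mult[of "v x * v y"] by (rule mult_right_mono) simp
      then show "v x * v y * iprod W (f (unit_vec x)) (f (unit_vec y))
          \<le> (C * vnorm V v)\<^sup>2 * \<bar>iprod W (f (unit_vec x)) (f (unit_vec y))\<bar>"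
        by linarith
    qed
    also have "\<dots> = (C * sqrt B * vnorm V v)\<^sup>2"
      using B by (simp add: B_def sum_distrib_left[symmetric] power_mult_distrib)
    finally show "(vnorm W (f v))\<^sup>2 \<le> (C * sqrt B * vnorm V v)\<^sup>2" .
    show "0 \<le> C * sqrt B * vnorm V v" using C(1) B S.vnorm_nonneg[OF v] by simp
  qed
  then show ?thesis unfolding bounded_linear_map_def using f add scale by blast
qed

end

section \<open>Pushforwards\<close>

lemma pushforward_closed [simp]:
  "h \<in> X \<rightarrow>\<^sub>E UNIV \<Longrightarrow> pushforward X Y f h \<in> Y \<rightarrow>\<^sub>E UNIV"
  by (simp add: pushforward_def)

lemma pushforward_apply:
  "h \<in> X \<rightarrow>\<^sub>E UNIV \<Longrightarrow> y \<in> Y \<Longrightarrow> pushforward X Y f h y = (\<Sum>x\<in>{x \<in> X. f x = y}. h x)"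
  by (simp add: pushforward_def)

lemma pushforward_cong:
  assumes "\<And>x. x \<in> X \<Longrightarrow> f x = g x"
  shows "pushforward X Y f = pushforward X Y g"
proof -
  have "{x \<in> X. f x = y} = {x \<in> X. g x = y}" for y using assms by auto
  then show ?thesis by (simp add: pushforward_def)
qed

lemma pushforward_compose:
  assumes X: "finite X" and Y: "finite Y" and f: "\<And>x. x \<in> X \<Longrightarrow> f x \<in> Y" and h: "h \<in> X \<rightarrow>\<^sub>E UNIV"
  shows "pushforward Y Z g (pushforward X Y f h) = pushforward X Z (\<lambda>x. g (f x)) h"
proof
  fix z
  show "pushforward Y Z g (pushforward X Y f h) z = pushforward X Z (\<lambda>x. g (f x)) h z"
  proof (cases "z \<in> Z")
    case True
    \<comment> \<open>Each fibre of \<open>f\<close> is rewritten as a fibre inside the fibre of the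
      composite over \<open>z\<close>, the shape required by \<open>sum.group\<close>.\<close>
    have "pushforward Y Z g (pushforward X Y f h) z
        = (\<Sum>y\<in>{y \<in> Y. g y = z}. \<Sum>x\<in>{x \<in> {x \<in> X. g (f x) = z}. f x = y}. h x)"
      using True h by (auto simp: pushforward_apply intro!: sum.cong)
    also have "\<dots> = (\<Sum>x\<in>{x \<in> X. g (f x) = z}. h x)"
      by (rule sum.group) (use X Y f in auto)
    finally show ?thesis using True h by (simp add: pushforward_apply)
  qed (use h in \<open>simp add: pushforward_def\<close>)
qed

lemma pushforward_id:
  assumes "h \<in> X \<rightarrow>\<^sub>E UNIV"
  shows "pushforward X X (\<lambda>x. x) h = h"
proof
  fix y
  have "{x \<in> X. x = y} = (if y \<in> X then {y} else {})" by auto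
  then show "pushforward X X (\<lambda>x. x) h y = h y"
    using assms by (auto simp: pushforward_def PiE_iff extensional_def)
qed

lemma pushforward_indicator:
  assumes X: "finite X" and x: "x \<in> X"
  shows "pushforward X Y f (\<lambda>z\<in>X. indicator {x} z) = (\<lambda>z\<in>Y. indicator {f x} z)"
proof
  fix y
  show "pushforward X Y f (\<lambda>z\<in>X. indicator {x} z) y = (\<lambda>z\<in>Y. indicator {f x} z) y"
  proof (cases "y \<in> Y")
    case True
    have "(\<Sum>z\<in>{z \<in> X. f z = y}. indicator {x} z) = (\<Sum>z\<in>{z \<in> X. f z = y}. if z = x then 1 else 0 :: real)"
      by (intro sum.cong) auto
    also have "\<dots> = indicator {f x} y" using X x by (auto simp: sum.delta)
    finally show ?thesis using True by (simp add: pushforward_apply)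
  qed (simp add: pushforward_def)
qed

lemma bounded_linear_map_pushforward:
  assumes X: "finite X" and V: "inner_product_space (free_space X p)"
    and W: "inner_product_space (free_space Y q)"
  shows "bounded_linear_map (free_space X p) (free_space Y q) (pushforward X Y f)"
proof -
  interpret finite_free_space X p using X V by (rule finite_free_space.intro)
  show ?thesis
  proof (rule bounded_linear_mapI[OF W])
    show "pushforward X Y f \<in> carrier V \<rightarrow>\<^sub>E carrier (free_space Y q)"
      by (auto simp: pushforward_def)
  next
    fix h k assume "h \<in> carrier V" "k \<in> carrier V"
    then show "pushforward X Y f (h \<oplus>\<^bsub>V\<^esub> k)
        = pushforward X Y f h \<oplus>\<^bsub>free_space Y q\<^esub> pushforward X Y f k"
      by (auto simp: pushforward_def fun_eq_iff sum.distrib)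
  next
    fix c h assume "h \<in> carrier V"
    then show "pushforward X Y f (c \<odot>\<^bsub>V\<^esub> h) = c \<odot>\<^bsub>free_space Y q\<^esub> pushforward X Y f h"
      by (auto simp: pushforward_def fun_eq_iff sum_distrib_left)
  qed
qed

section \<open>Extended exponential and logarithm\<close>

lemma exp_ext_nonneg [simp]: "0 \<le> exp_ext t"
  by (simp add: exp_ext_def)

text \<open>The double minus arises when a value of \<open>psi\<close> is inserted into the weight
  \<open>exp_ext (- h)\<close>; \<open>exp_ext_psi\<close> therefore disables its
  cancellation.\<close>

lemma exp_ext_minus_ln_ext [simp]: "0 \<le> s \<Longrightarrow> exp_ext (- (- ln_ext s)) = s"
  by (simp add: exp_ext_def ln_ext_def)

lemma ln_ext_exp_ext [simp]: "h \<noteq> - \<infinity> \<Longrightarrow> - ln_ext (exp_ext (- h)) = h"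
  by (cases h) (auto simp: exp_ext_def ln_ext_def)

lemma ln_ext_neq_infinity [simp]: "ln_ext s \<noteq> \<infinity>" "\<infinity> \<noteq> ln_ext s"
  by (auto simp: ln_ext_def)

text \<open>At \<open>h = \<infinity>\<close> both sides vanish. The excluded value would break the
  product rule, because \<open>real_of_ereal\<close> is 0 at \<infinity>.\<close>

lemma exp_ext_shift:
  assumes "h \<noteq> - \<infinity>"
  shows "exp_ext (- h + ereal t - 1) = exp_ext (- h) * exp (t - 1)"
  using assms by (cases h) (auto simp: exp_ext_def one_ereal_def exp_add[symmetric])

text \<open>The maps \<open>h \<mapsto> exp (- h)\<close> and \<open>s \<mapsto> - ln s\<close> are mutually inverse and order reversing
  between \<open>(-\<infinity>, +\<infinity>]\<close> and \<open>[0, +\<infinity>)\<close>, hence both are continuous.\<close>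

lemma exp_ext_minus_less_iff:
  assumes "h \<noteq> - \<infinity>" "0 \<le> s"
  shows "exp_ext (- h) < s \<longleftrightarrow> - ln_ext s < h"
proof (cases h)
  case (real r)
  have "exp (- r) < s \<longleftrightarrow> - ln s < r" if "s \<noteq> 0"
    using that assms(2) ln_less_cancel_iff[of "exp (- r)" s] by (simp, linarith)
  then show ?thesis using real assms(2) by (auto simp: exp_ext_def ln_ext_def not_less)
qed (use assms in \<open>auto simp: exp_ext_def ln_ext_def\<close>)

lemma less_exp_ext_minus_iff:
  assumes "h \<noteq> - \<infinity>" "0 \<le> s"
  shows "s < exp_ext (- h) \<longleftrightarrow> h < - ln_ext s"
proof (cases h)
  case (real r)
  have "s < exp (- r) \<longleftrightarrow> r < - ln s" if "s \<noteq> 0"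
    using that assms(2) ln_less_cancel_iff[of s "exp (- r)"] by (simp, linarith)
  then show ?thesis using real assms(2) by (auto simp: exp_ext_def ln_ext_def)
qed (use assms in \<open>auto simp: exp_ext_def ln_ext_def\<close>)

lemma continuous_on_exp_ext_minus: "continuous_on {h. h \<noteq> - \<infinity>} (\<lambda>h. exp_ext (- h))"
  unfolding continuous_on_def
proof (intro ballI order_tendstoI)
  fix h0 :: ereal and a :: real
  assume h0: "h0 \<in> {h. h \<noteq> - \<infinity>}" and a: "a < exp_ext (- h0)"
  show "\<forall>\<^sub>F h in at h0 within {h. h \<noteq> - \<infinity>}. a < exp_ext (- h)"
  proof (cases "0 \<le> a")
    case True
    \<comment> \<open>The preimage of the open ray above \<open>a\<close> is the open ray below the
      image of \<open>a\<close> under the inverse map.\<close>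
    then show ?thesis
      using h0 a unfolding eventually_at_topological
      by (intro exI[of _ "{..<- ln_ext a}"]) (auto simp: less_exp_ext_minus_iff)
  next
    case False
    then have "a < exp_ext (- h)" for h using exp_ext_nonneg[of "- h"] by linarith
    then show ?thesis by simp
  qed
next
  fix h0 :: ereal and a :: real
  assume h0: "h0 \<in> {h. h \<noteq> - \<infinity>}" and a: "exp_ext (- h0) < a"
  then have "0 \<le> a" using exp_ext_nonneg[of "- h0"] by linarith
  then show "\<forall>\<^sub>F h in at h0 within {h. h \<noteq> - \<infinity>}. exp_ext (- h) < a"
    using h0 a unfolding eventually_at_topological
    by (intro exI[of _ "{- ln_ext a<..}"]) (auto simp: exp_ext_minus_less_iff)
qed

lemma continuous_on_minus_ln_ext: "continuous_on {0..} (\<lambda>s. - ln_ext s)"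
  unfolding continuous_on_def
proof (intro ballI order_tendstoI)
  fix s0 :: real and a :: ereal assume s0: "s0 \<in> {0..}" and a: "a < - ln_ext s0"
  show "\<forall>\<^sub>F s in at s0 within {0..}. a < - ln_ext s"
  \<comment> \<open>Here \<open>exp_ext (- a)\<close> is not an inverse image of \<open>a\<close>,
    but the bound holds everywhere since \<open>ln_ext\<close> never takes the value
    \<infinity>.\<close>
  proof (cases "a = - \<infinity>")
    case True
    then show ?thesis by (simp add: less_le)
  next
    case False
    then show ?thesis
      using s0 a unfolding eventually_at_topological
      by (intro exI[of _ "{..<exp_ext (- a)}"]) (auto simp: less_exp_ext_minus_iff)
  qed
next
  fix s0 :: real and a :: ereal assume s0: "s0 \<in> {0..}" and a: "- ln_ext s0 < a"
  then have "a \<noteq> - \<infinity>" by auto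
  then show "\<forall>\<^sub>F s in at s0 within {0..}. - ln_ext s < a"
    using s0 a unfolding eventually_at_topological
    by (intro exI[of _ "{exp_ext (- a)<..}"]) (auto simp: exp_ext_minus_less_iff)
qed

section \<open>Naturality of the message-passing operators\<close>

lemma topspace_hamiltonians [simp]:
  "topspace (hamiltonians A F) = (\<Pi>\<^sub>E a\<in>A. \<Pi>\<^sub>E x\<in>ob F a. {h. h \<noteq> - \<infinity>})"
  by (simp add: hamiltonians_def)

lemma presheaf_finite: "F \<in> presheaves A \<Longrightarrow> a \<in> A \<Longrightarrow> finite (ob F a)"
  by (auto simp: presheaves_def)

lemma presheaf_res:
  "\<lbrakk>F \<in> presheaves A; (a, b) \<in> below A; x \<in> ob F a\<rbrakk> \<Longrightarrow> res F (a, b) x \<in> ob F b"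
  by (fastforce simp: presheaves_def PiE_iff)

lemma nat_trans_closed: "\<lbrakk>\<phi> \<in> nat_trans A F G; a \<in> A; x \<in> ob F a\<rbrakk> \<Longrightarrow> \<phi> a x \<in> ob G a"
  by (fastforce simp: nat_trans_def PiE_iff)

lemma nat_trans_natural:
  "\<lbrakk>\<phi> \<in> nat_trans A F G; (a, b) \<in> below A; x \<in> ob F a\<rbrakk>
    \<Longrightarrow> res G (a, b) (\<phi> a x) = \<phi> b (res F (a, b) x)"
  by (fastforce simp: nat_trans_def)

lemma belowD: "(a, b) \<in> below A \<Longrightarrow> a \<in> A \<and> b \<in> A"
  by (auto simp: below_def)

lemma finite_below: "finite A \<Longrightarrow> finite (below A)"
  by (rule finite_subset[of _ "A \<times> A"]) (auto simp: below_def)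

lemma psi_closed: "H \<in> topspace (hamiltonians A F) \<Longrightarrow> psi A F G \<phi> H \<in> topspace (hamiltonians A G)"
  by (auto simp: psi_def)

text \<open>On the weights \<open>exp_ext (- H a x)\<close> the map \<open>psi\<close> is the linear
  pushforward, infinite energy being weight 0. Both \<open>push_g_op\<close> and the composition law
  for \<open>psi\<close> rest on this.\<close>

lemma exp_ext_psi:
  "\<lbrakk>H \<in> topspace (hamiltonians A F); a \<in> A; y \<in> ob G a\<rbrakk>
    \<Longrightarrow> exp_ext (- psi A F G \<phi> H a y) = (\<Sum>x\<in>{x \<in> ob F a. \<phi> a x = y}. exp_ext (- H a x))"
  by (simp add: psi_def sum_nonneg del: ereal_uminus_uminus)

text \<open>Each component passes through the weights: evaluation, \<open>exp_ext (- h)\<close>, a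
  finite sum with values in the closed half line, and back by \<open>- ln_ext\<close>. Infinite
  energies are covered since both changes of variable are continuous there; an empty fibre gives the
  constant \<infinity>.\<close>

lemma continuous_map_psi:
  assumes fin: "\<And>a. a \<in> A \<Longrightarrow> finite (ob F a)"
  shows "continuous_map (hamiltonians A F) (hamiltonians A G) (psi A F G \<phi>)"
proof -
  let ?E = "subtopology euclidean {h::ereal. h \<noteq> - \<infinity>}"
  have proj: "continuous_map (hamiltonians A F) ?E (\<lambda>H. H a x)" if "a \<in> A" "x \<in> ob F a" for a x
  proof -
    have "continuous_map (hamiltonians A F) (product_topology (\<lambda>x. ?E) (ob F a)) (\<lambda>H. H a)"
      unfolding hamiltonians_def
      by (rule continuous_map_product_projection[OF that(1),
            where X = "\<lambda>a. product_topology (\<lambda>x. ?E) (ob F a)"])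
    from continuous_map_compose[OF this continuous_map_product_projection[OF that(2), where X = "\<lambda>x. ?E"]]
    show ?thesis by (simp add: o_def)
  qed
  have exp: "continuous_map ?E euclideanreal (\<lambda>h. exp_ext (- h))"
    using continuous_on_exp_ext_minus by simp
  have ln: "continuous_map (top_of_set {0..}) ?E (\<lambda>s. - ln_ext s)"
    using continuous_on_minus_ln_ext by (auto simp: continuous_map_in_subtopology)
  have comp: "continuous_map (hamiltonians A F) ?E
      (\<lambda>H. - ln_ext (\<Sum>x\<in>{x \<in> ob F a. \<phi> a x = y}. exp_ext (- H a x)))" if a: "a \<in> A" for a y
  proof -
    have "continuous_map (hamiltonians A F) euclideanreal
        (\<lambda>H. \<Sum>x\<in>{x \<in> ob F a. \<phi> a x = y}. exp_ext (- H a x))"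
      using continuous_map_compose[OF proj[OF a] exp] fin[OF a]
      by (intro continuous_map_sum) (auto simp: o_def)
    then have "continuous_map (hamiltonians A F) (top_of_set {0..})
        (\<lambda>H. \<Sum>x\<in>{x \<in> ob F a. \<phi> a x = y}. exp_ext (- H a x))"
      by (auto simp: continuous_map_in_subtopology intro!: sum_nonneg)
    from continuous_map_compose[OF this ln] show ?thesis by (simp add: o_def)
  qed
  have "continuous_map (hamiltonians A F) (hamiltonians A G) (\<lambda>H. \<lambda>a\<in>A. \<lambda>y\<in>ob G a.
      - ln_ext (\<Sum>x\<in>{x \<in> ob F a. \<phi> a x = y}. exp_ext (- H a x)))"
    unfolding hamiltonians_def[of A G] using comp
    by (auto simp: continuous_map_componentwise)
  then show ?thesis by (rule continuous_map_eq) (simp add: psi_def)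
qed

section \<open>The operators for a fixed choice of scalar products\<close>

locale message_passing =
  fixes A :: "'a::order set" and ip :: "('a, 'x) scalar_products"
  assumes finite_poset: "finite A"
    and scalar_product: "\<And>F a. F \<in> presheaves A \<Longrightarrow> a \<in> A \<Longrightarrow> inner_product_space (lin ip F a)"
begin

lemma lin_simps [simp]: "carrier (lin ip F a) = ob F a \<rightarrow>\<^sub>E UNIV" "iprod (lin ip F a) = ip F a"
  by (simp_all add: lin_def)

lemma finite_free_space_lin:
  "F \<in> presheaves A \<Longrightarrow> a \<in> A \<Longrightarrow> finite_free_space (ob F a) (ip F a)"
  using scalar_product presheaf_finite by (simp add: finite_free_space_def lin_def)

lemma hilbert_lin: "F \<in> presheaves A \<Longrightarrow> a \<in> A \<Longrightarrow> hilbert_space (lin ip F a)"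
  using finite_free_space.hilbert[OF finite_free_space_lin] by (simp add: lin_def)

lemma lin_diff:
  "\<lbrakk>F \<in> presheaves A; a \<in> A; f \<in> ob F a \<rightarrow>\<^sub>E UNIV; g \<in> ob F a \<rightarrow>\<^sub>E UNIV\<rbrakk>
    \<Longrightarrow> f \<ominus>\<^bsub>lin ip F a\<^esub> g = (\<lambda>x\<in>ob F a. f x - g x)"
  using finite_free_space.diff_eq[OF finite_free_space_lin] by (simp add: lin_def)

lemma bounded_pushforward:
  "\<lbrakk>F \<in> presheaves A; G \<in> presheaves A; a \<in> A; b \<in> A\<rbrakk>
    \<Longrightarrow> bounded_linear_map (lin ip F a) (lin ip G b) (pushforward (ob F a) (ob G b) f)"
  using scalar_product[of F a] scalar_product[of G b] presheaf_finite[of F A a]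
  by (simp add: lin_def bounded_linear_map_pushforward)

lemma bounded_lin_res:
  "\<lbrakk>F \<in> presheaves A; a \<in> A; b \<in> A\<rbrakk> \<Longrightarrow> bounded_linear_map (lin ip F a) (lin ip F b) (lin_res F a b)"
  by (simp add: lin_res_def bounded_pushforward)

lemma lin_res_adj_closed:
  "\<lbrakk>F \<in> presheaves A; a \<in> A; b \<in> A; v \<in> ob F b \<rightarrow>\<^sub>E UNIV\<rbrakk>
    \<Longrightarrow> lin_res_adj ip F a b v \<in> ob F a \<rightarrow>\<^sub>E UNIV"
  using adjoint_closed[of "lin ip F a" "lin ip F b" "lin_res F a b" v]
  by (simp add: lin_res_adj_def hilbert_lin scalar_product bounded_lin_res)

lemma messages_carrier:
  "carrier (messages A ip F) = (\<Pi>\<^sub>E (a, b)\<in>below A. ob F b \<rightarrow>\<^sub>E UNIV)"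
  by (simp add: messages_def case_prod_unfold)

lemma hilbert_messages: "F \<in> presheaves A \<Longrightarrow> hilbert_space (messages A ip F)"
  unfolding messages_def
  by (rule hilbert_space_direct_sum) (auto simp: finite_below finite_poset intro: hilbert_lin dest: belowD)

lemma messages_ip: "F \<in> presheaves A \<Longrightarrow> inner_product_space (messages A ip F)"
  using hilbert_messages by (simp add: hilbert_space_def)

lemma finsum_lin_closed:
  assumes "F \<in> presheaves A" "a \<in> A" "\<And>i. i \<in> I \<Longrightarrow> f i \<in> ob F a \<rightarrow>\<^sub>E UNIV"
  shows "(\<Oplus>\<^bsub>lin ip F a\<^esub>i\<in>I. f i) \<in> ob F a \<rightarrow>\<^sub>E UNIV"
proof -
  interpret L: ip_space "lin ip F a" using scalar_product[OF assms(1,2)] by (rule ip_space.intro)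
  have "f \<in> I \<rightarrow> carrier (lin ip F a)" using assms(3) by auto
  from L.finsum_closed[OF this] show ?thesis by simp
qed

lemma d_op_closed:
  assumes F: "F \<in> presheaves A" and l: "l \<in> carrier (messages A ip F)" and a: "a \<in> A"
  shows "d_op A ip F l a \<in> ob F a \<rightarrow>\<^sub>E UNIV"
proof -
  have l': "l (b, c) \<in> ob F c \<rightarrow>\<^sub>E UNIV" if "(b, c) \<in> below A" for b c
    using l that unfolding messages_carrier by (auto dest: PiE_mem)
  interpret L: ip_space "lin ip F a" using scalar_product[OF F a] by (rule ip_space.intro)
  have "(\<Oplus>\<^bsub>lin ip F a\<^esub>b\<in>{b \<in> A. b \<le> a}. lin_res_adj ip F a b (l (a, b))) \<in> ob F a \<rightarrow>\<^sub>E UNIV"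
    using F a l' by (intro finsum_lin_closed lin_res_adj_closed) (auto simp: below_def)
  moreover have "(\<Oplus>\<^bsub>lin ip F a\<^esub>b\<in>{b \<in> A. a \<le> b}. l (b, a)) \<in> ob F a \<rightarrow>\<^sub>E UNIV"
    using F a l' by (intro finsum_lin_closed) (auto simp: below_def)
  ultimately show ?thesis using a L.minus_closed by (simp add: d_op_def)
qed

lemma zeta_op_closed:
  assumes "F \<in> presheaves A" "a \<in> A" "\<And>b. b \<in> A \<Longrightarrow> v b \<in> ob F b \<rightarrow>\<^sub>E UNIV"
  shows "zeta_op A ip F v a \<in> ob F a \<rightarrow>\<^sub>E UNIV"
proof -
  have "(\<Oplus>\<^bsub>lin ip F a\<^esub>b\<in>{b \<in> A. b \<le> a}. lin_res_adj ip F a b (v b)) \<in> ob F a \<rightarrow>\<^sub>E UNIV"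
    using assms by (intro finsum_lin_closed lin_res_adj_closed) auto
  then show ?thesis using assms(2) by (simp add: zeta_op_def)
qed

lemma g_op_closed: "a \<in> A \<Longrightarrow> g_op A ip F H v a \<in> ob F a \<rightarrow>\<^sub>E UNIV"
  by (simp add: g_op_def)

lemma delta_op_closed:
  assumes F: "F \<in> presheaves A" and v: "\<And>a. a \<in> A \<Longrightarrow> v a \<in> ob F a \<rightarrow>\<^sub>E UNIV"
  shows "delta_op A ip F v \<in> carrier (messages A ip F)"
proof -
  have "lin_res F a b (v a) \<ominus>\<^bsub>lin ip F b\<^esub> v b \<in> ob F b \<rightarrow>\<^sub>E UNIV" if "(a, b) \<in> below A" for a b
    using belowD[OF that] v F by (simp add: lin_diff lin_res_def)
  then show ?thesis unfolding messages_carrier delta_op_def by (intro PiE_I) auto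
qed

lemma Delta_MP_closed:
  assumes "F \<in> presheaves A"
  shows "Delta_MP A ip F H l \<in> carrier (messages A ip F)"
  unfolding Delta_MP_def by (intro delta_op_closed assms g_op_closed)

end

section \<open>Intertwining of the operators with a natural transformation\<close>

locale message_passing_morphism = message_passing A ip
  for A :: "'a::order set" and ip :: "('a, 'x) scalar_products" +
  fixes F G :: "('a, 'x) presheaf" and \<phi> :: "'a \<Rightarrow> 'x \<Rightarrow> 'x"
  assumes F: "F \<in> presheaves A" and G: "G \<in> presheaves A" and \<phi>: "\<phi> \<in> nat_trans A F G"
begin

definition push :: "'a \<Rightarrow> ('x \<Rightarrow> real) \<Rightarrow> 'x \<Rightarrow> real" where
  "push a = pushforward (ob F a) (ob G a) (\<phi> a)"

text \<open>For the standard scalar products this would be precomposition with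
  \<open>\<phi> a\<close>; for arbitrary ones it depends on both scalar products at
  \<open>a\<close>.\<close>

definition pull :: "'a \<Rightarrow> ('x \<Rightarrow> real) \<Rightarrow> 'x \<Rightarrow> real" where
  "pull a = adjoint (lin ip F a) (lin ip G a) (push a)"

lemma bounded_push: "a \<in> A \<Longrightarrow> bounded_linear_map (lin ip F a) (lin ip G a) (push a)"
  unfolding push_def by (rule bounded_pushforward) (use F G in auto)

lemma pull_closed: "a \<in> A \<Longrightarrow> v \<in> ob G a \<rightarrow>\<^sub>E UNIV \<Longrightarrow> pull a v \<in> ob F a \<rightarrow>\<^sub>E UNIV"
  using adjoint_closed[OF hilbert_lin[OF F] scalar_product[OF G] bounded_push, of a]
  by (simp add: pull_def)

text \<open>Both sides are the pushforward along the diagonal of the naturality square of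
  \<phi>.\<close>

lemma push_lin_res:
  assumes ab: "(a, b) \<in> below A" and v: "v \<in> ob F a \<rightarrow>\<^sub>E UNIV"
  shows "push b (lin_res F a b v) = lin_res G a b (push a v)"
proof -
  have a: "a \<in> A" and b: "b \<in> A" using belowD[OF ab] by auto
  note fin = presheaf_finite[OF F a] presheaf_finite[OF F b] presheaf_finite[OF G a]
  have "push b (lin_res F a b v) = pushforward (ob F a) (ob G b) (\<lambda>x. \<phi> b (res F (a, b) x)) v"
    unfolding push_def lin_res_def
    by (rule pushforward_compose[OF fin(1,2) presheaf_res[OF F ab] v])
  also have "\<dots> = pushforward (ob F a) (ob G b) (\<lambda>x. res G (a, b) (\<phi> a x)) v"
    by (rule fun_cong[OF pushforward_cong]) (use nat_trans_natural[OF \<phi> ab] in simp)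
  also have "\<dots> = lin_res G a b (push a v)"
    unfolding push_def lin_res_def
    by (rule pushforward_compose[OF fin(1,3) nat_trans_closed[OF \<phi> a] v, symmetric])
  finally show ?thesis .
qed

text \<open>The adjoint of the square \<open>push_lin_res\<close>, with all arrows reversed. The
  square is first stated as an equality of extensional composites, so that adjoints of the two sides
  can be compared.\<close>

lemma lin_res_adj_pull:
  assumes ab: "(a, b) \<in> below A" and v: "v \<in> ob G b \<rightarrow>\<^sub>E UNIV"
  shows "lin_res_adj ip F a b (pull b v) = pull a (lin_res_adj ip G a b v)"
proof -
  have a: "a \<in> A" and b: "b \<in> A" using belowD[OF ab] by auto
  have eq: "compose (carrier (lin ip F a)) (push b) (lin_res F a b)
      = compose (carrier (lin ip F a)) (lin_res G a b) (push a)"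
    using push_lin_res[OF ab] by (auto simp: compose_def fun_eq_iff)
  have "lin_res_adj ip F a b (pull b v)
      = adjoint (lin ip F a) (lin ip G b) (compose (carrier (lin ip F a)) (push b) (lin_res F a b)) v"
    using v adjoint_compose[OF hilbert_lin[OF F a] hilbert_lin[OF F b] scalar_product[OF G b]
        bounded_lin_res[OF F a b] bounded_push[OF b]]
    by (simp add: lin_res_adj_def pull_def compose_def)
  also have "\<dots> = pull a (lin_res_adj ip G a b v)"
    unfolding eq
    using v adjoint_compose[OF hilbert_lin[OF F a] hilbert_lin[OF G a] scalar_product[OF G b]
        bounded_push[OF a] bounded_lin_res[OF G a b]]
    by (simp add: lin_res_adj_def pull_def compose_def)
  finally show ?thesis .
qed

lemma pull_finsum:
  assumes "a \<in> A" "finite I" "\<And>i. i \<in> I \<Longrightarrow> f i \<in> ob G a \<rightarrow>\<^sub>E UNIV"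
  shows "(\<Oplus>\<^bsub>lin ip F a\<^esub>i\<in>I. pull a (f i)) = pull a (\<Oplus>\<^bsub>lin ip G a\<^esub>i\<in>I. f i)"
  using adjoint_finsum[OF hilbert_lin[OF F] scalar_product[OF G] bounded_push, of a I f] assms
  by (simp add: pull_def)

text \<open>The common core of \<open>zeta_op\<close> and of the first sum in \<open>d_op\<close>.
  The assumptions are confined to \<open>b \<le> a\<close> because in \<open>d_op\<close> the family
  \<open>v b\<close> is the message \<open>l (a, b)\<close>, which exists only for such
  \<open>b\<close>.\<close>

lemma finsum_lin_res_adj_pull:
  assumes a: "a \<in> A" and v: "\<And>b. b \<in> A \<Longrightarrow> b \<le> a \<Longrightarrow> v b \<in> ob G b \<rightarrow>\<^sub>E UNIV"
    and w: "\<And>b. b \<in> A \<Longrightarrow> b \<le> a \<Longrightarrow> w b = pull b (v b)"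
  shows "(\<Oplus>\<^bsub>lin ip F a\<^esub>b\<in>{b \<in> A. b \<le> a}. lin_res_adj ip F a b (w b))
    = pull a (\<Oplus>\<^bsub>lin ip G a\<^esub>b\<in>{b \<in> A. b \<le> a}. lin_res_adj ip G a b (v b))"
proof -
  interpret L: ip_space "lin ip F a" using scalar_product[OF F a] by (rule ip_space.intro)
  have closed: "lin_res_adj ip G a b (v b) \<in> ob G a \<rightarrow>\<^sub>E UNIV" if "b \<in> A" "b \<le> a" for b
    using that a G v by (intro lin_res_adj_closed)
  have "(\<Oplus>\<^bsub>lin ip F a\<^esub>b\<in>{b \<in> A. b \<le> a}. lin_res_adj ip F a b (w b))
      = (\<Oplus>\<^bsub>lin ip F a\<^esub>b\<in>{b \<in> A. b \<le> a}. pull a (lin_res_adj ip G a b (v b)))"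
  proof (rule L.finsum_cong')
    show "(\<lambda>b. pull a (lin_res_adj ip G a b (v b))) \<in> {b \<in> A. b \<le> a} \<rightarrow> carrier (lin ip F a)"
      using pull_closed[OF a closed] by simp
    show "lin_res_adj ip F a b (w b) = pull a (lin_res_adj ip G a b (v b))"
      if "b \<in> {b \<in> A. b \<le> a}" for b
      using that a v w lin_res_adj_pull[of a b "v b"] by (simp add: below_def)
  qed simp
  also have "\<dots> = pull a (\<Oplus>\<^bsub>lin ip G a\<^esub>b\<in>{b \<in> A. b \<le> a}. lin_res_adj ip G a b (v b))"
    by (rule pull_finsum) (use a finite_poset closed in auto)
  finally show ?thesis .
qed

lemma zeta_op_pull:
  assumes "a \<in> A" "\<And>b. b \<in> A \<Longrightarrow> v b \<in> ob G b \<rightarrow>\<^sub>E UNIV" "\<And>b. b \<in> A \<Longrightarrow> w b = pull b (v b)"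
  shows "zeta_op A ip F w a = pull a (zeta_op A ip G v a)"
  using finsum_lin_res_adj_pull[of a v w] assms by (simp add: zeta_op_def)

lemma phi_one_eq:
  "phi_one A ip F G \<phi> = direct_sum_map (below A) (\<lambda>(a, b). lin ip F b) (\<lambda>(a, b). push b)"
  by (auto simp: phi_one_def direct_sum_map_def messages_def push_def case_prod_unfold restrict_def fun_eq_iff)

lemma bounded_phi_one:
  "bounded_linear_map (messages A ip F) (messages A ip G) (phi_one A ip F G \<phi>)"
  unfolding phi_one_eq messages_def
  by (rule bounded_linear_map_direct_sum_map)
    (auto simp: finite_below finite_poset intro: scalar_product F G bounded_push dest: belowD)

lemma adjoint_phi_one:
  assumes "l \<in> carrier (messages A ip G)" "(a, b) \<in> below A"
  shows "adjoint (messages A ip F) (messages A ip G) (phi_one A ip F G \<phi>) l (a, b) = pull b (l (a, b))"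
proof -
  have "adjoint (messages A ip F) (messages A ip G) (phi_one A ip F G \<phi>)
      = direct_sum_map (below A) (\<lambda>(a, b). lin ip G b)
          (\<lambda>i. adjoint ((\<lambda>(a, b). lin ip F b) i) ((\<lambda>(a, b). lin ip G b) i) ((\<lambda>(a, b). push b) i))"
    unfolding phi_one_eq messages_def
    by (rule adjoint_direct_sum_map)
      (auto simp: finite_below finite_poset intro: hilbert_lin scalar_product F G bounded_push dest: belowD)
  then show ?thesis using assms by (simp add: direct_sum_map_def messages_def pull_def)
qed

text \<open>In the first sum \<open>pull\<close> has to be moved past the adjoint restrictions; in
  the second the messages already live at \<open>a\<close>, and additivity is enough.\<close>

lemma d_op_pull:
  assumes l: "l \<in> carrier (messages A ip G)" and a: "a \<in> A"
  shows "d_op A ip F (adjoint (messages A ip F) (messages A ip G) (phi_one A ip F G \<phi>) l) a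
    = pull a (d_op A ip G l a)"
proof -
  let ?l = "adjoint (messages A ip F) (messages A ip G) (phi_one A ip F G \<phi>) l"
  have l': "l (b, c) \<in> ob G c \<rightarrow>\<^sub>E UNIV" if "(b, c) \<in> below A" for b c
    using l that unfolding messages_carrier by (auto dest: PiE_mem)
  interpret L: ip_space "lin ip F a" using scalar_product[OF F a] by (rule ip_space.intro)
  let ?s = "\<Oplus>\<^bsub>lin ip G a\<^esub>b\<in>{b \<in> A. b \<le> a}. lin_res_adj ip G a b (l (a, b))"
  let ?t = "\<Oplus>\<^bsub>lin ip G a\<^esub>b\<in>{b \<in> A. a \<le> b}. l (b, a)"
  have "(\<Oplus>\<^bsub>lin ip F a\<^esub>b\<in>{b \<in> A. b \<le> a}. lin_res_adj ip F a b (?l (a, b))) = pull a ?s"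
    by (rule finsum_lin_res_adj_pull)
      (use a l' adjoint_phi_one[OF l] in \<open>auto simp: below_def\<close>)
  moreover have "(\<Oplus>\<^bsub>lin ip F a\<^esub>b\<in>{b \<in> A. a \<le> b}. ?l (b, a))
      = (\<Oplus>\<^bsub>lin ip F a\<^esub>b\<in>{b \<in> A. a \<le> b}. pull a (l (b, a)))"
  proof (rule L.finsum_cong')
    show "(\<lambda>b. pull a (l (b, a))) \<in> {b \<in> A. a \<le> b} \<rightarrow> carrier (lin ip F a)"
      using pull_closed[OF a l'] a by (simp add: below_def)
  qed (use a adjoint_phi_one[OF l] in \<open>auto simp: below_def\<close>)
  moreover have "\<dots> = pull a ?t"
    by (rule pull_finsum) (use a l' finite_poset in \<open>auto simp: below_def\<close>)
  moreover have "?s \<in> ob G a \<rightarrow>\<^sub>E UNIV"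
    using G a l' by (intro finsum_lin_closed lin_res_adj_closed) (auto simp: below_def)
  moreover have "?t \<in> ob G a \<rightarrow>\<^sub>E UNIV"
    using G a l' by (intro finsum_lin_closed) (auto simp: below_def)
  ultimately show ?thesis
    using adjoint_diff[OF hilbert_lin[OF F a] scalar_product[OF G a] bounded_push[OF a], of ?s ?t] a
    by (simp add: d_op_def pull_def)
qed

lemma push_g_op:
  assumes H: "H \<in> topspace (hamiltonians A F)" and a: "a \<in> A"
    and v: "v a \<in> ob G a \<rightarrow>\<^sub>E UNIV" and w: "w a = pull a (v a)"
  shows "push a (g_op A ip F H w a) = g_op A ip G (psi A F G \<phi> H) v a"
proof
  fix y
  show "push a (g_op A ip F H w a) y = g_op A ip G (psi A F G \<phi> H) v a y"
  proof (cases "y \<in> ob G a")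
    case True
    let ?e = "\<lambda>z\<in>ob G a. indicator {y} z :: real"
    have fin: "finite (ob F a)" using presheaf_finite[OF F a] .
    \<comment> \<open>The adjunction moves \<open>pull\<close> from the potential to the indicator.
      Symmetry is used twice because \<open>adjoint_iprod\<close> has the adjoint in the second
      argument, whereas \<open>g_op\<close> has the potential in the first.\<close>
    have wx: "ip F a (w a) (\<lambda>z\<in>ob F a. indicator {x} z) = ip G a (v a) ?e"
      if x: "x \<in> ob F a" and y: "\<phi> a x = y" for x
    proof -
      let ?d = "\<lambda>z\<in>ob F a. indicator {x} z :: real"
      interpret LF: ip_space "lin ip F a" using scalar_product[OF F a] by (rule ip_space.intro)
      interpret LG: ip_space "lin ip G a" using scalar_product[OF G a] by (rule ip_space.intro)
      have "ip F a (w a) ?d = ip F a ?d (w a)"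
        using LF.iprod_commute[of "w a" ?d] pull_closed[OF a v] w by simp
      also have "\<dots> = ip G a (push a ?d) (v a)"
        using adjoint_iprod[OF hilbert_lin[OF F a] scalar_product[OF G a] bounded_push[OF a], of ?d "v a"] v w
        by (simp add: pull_def)
      also have "push a ?d = ?e" unfolding push_def y[symmetric] by (rule pushforward_indicator[OF fin x])
      also have "ip G a ?e (v a) = ip G a (v a) ?e"
        using LG.iprod_commute[of "v a" ?e] v by simp
      finally show ?thesis .
    qed
    have Hx: "H a x \<noteq> - \<infinity>" if "x \<in> ob F a" for x
      using PiE_mem[OF PiE_mem[OF H[unfolded topspace_hamiltonians] a] that] by simp
    have "psi A F G \<phi> H a y \<noteq> - \<infinity>" using H a True by (simp add: psi_def)
    then have "g_op A ip G (psi A F G \<phi> H) v a y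
        = exp_ext (- psi A F G \<phi> H a y) * exp (ip G a (v a) ?e - 1)"
      using a True by (simp add: g_op_def exp_ext_shift)
    \<comment> \<open>Outside the image of \<open>\<phi> a\<close> the fibre is empty, and the
      weight of the infinite energy is 0 as well.\<close>
    also have "\<dots> = (\<Sum>x\<in>{x \<in> ob F a. \<phi> a x = y}. exp_ext (- H a x) * exp (ip G a (v a) ?e - 1))"
      unfolding exp_ext_psi[OF H a True] by (rule sum_distrib_right)
    also have "\<dots> = (\<Sum>x\<in>{x \<in> ob F a. \<phi> a x = y}. g_op A ip F H w a x)"
      using a Hx by (intro sum.cong) (auto simp: g_op_def exp_ext_shift wx)
    also have "\<dots> = push a (g_op A ip F H w a) y"
      unfolding push_def using pushforward_apply[OF g_op_closed[OF a] True] by simp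
    finally show ?thesis by simp
  next
    case False
    \<comment> \<open>Off \<open>ob G a\<close> both sides are \<open>undefined\<close>.\<close>
    have "push a (g_op A ip F H w a) \<in> ob G a \<rightarrow>\<^sub>E UNIV"
      unfolding push_def by (rule pushforward_closed) (rule g_op_closed[OF a])
    then show ?thesis using False a by (simp add: g_op_def PiE_iff extensional_def)
  qed
qed

text \<open>No adjoint enters here: \<open>push\<close> respects differences and commutes with
  \<open>lin_res\<close>.\<close>

lemma phi_one_delta_op:
  assumes v: "\<And>a. a \<in> A \<Longrightarrow> v a \<in> ob F a \<rightarrow>\<^sub>E UNIV" and w: "\<And>a. a \<in> A \<Longrightarrow> w a = push a (v a)"
  shows "phi_one A ip F G \<phi> (delta_op A ip F v) = delta_op A ip G w"
proof -
  have "push b (lin_res F a b (v a) \<ominus>\<^bsub>lin ip F b\<^esub> v b) = lin_res G a b (w a) \<ominus>\<^bsub>lin ip G b\<^esub> w b"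
    if ab: "(a, b) \<in> below A" for a b
  proof -
    have a: "a \<in> A" and b: "b \<in> A" using belowD[OF ab] by auto
    have res: "lin_res F a b (v a) \<in> ob F b \<rightarrow>\<^sub>E UNIV"
      unfolding lin_res_def by (rule pushforward_closed[OF v[OF a]])
    have "push b (lin_res F a b (v a) \<ominus>\<^bsub>lin ip F b\<^esub> v b)
        = (\<lambda>y\<in>ob G b. push b (lin_res F a b (v a)) y - push b (v b) y)"
      using res v[OF b] by (auto simp: lin_diff[OF F b] push_def pushforward_def sum_subtractf fun_eq_iff)
    also have "\<dots> = push b (lin_res F a b (v a)) \<ominus>\<^bsub>lin ip G b\<^esub> push b (v b)"
      by (rule lin_diff[OF G b, symmetric]) (use res v[OF b] in \<open>simp_all add: push_def\<close>)
    finally show ?thesis using push_lin_res[OF ab v[OF a]] w a b by simp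
  qed
  then show ?thesis
    using delta_op_closed[OF F v]
    by (auto simp: phi_one_def push_def delta_op_def fun_eq_iff)
qed

text \<open>The turning point is \<open>g_op\<close>: before it the two computations are related by
  \<open>pull\<close> from \<open>G\<close> to \<open>F\<close>, after it by \<open>push\<close>
  from \<open>F\<close> to \<open>G\<close>. This is the origin of the shape of the law for
  morphisms in MPA.\<close>

lemma Delta_MP_natural:
  assumes l: "l \<in> carrier (messages A ip G)" and H: "H \<in> topspace (hamiltonians A F)"
  shows "Delta_MP A ip G (psi A F G \<phi> H) l = phi_one A ip F G \<phi>
    (Delta_MP A ip F H (adjoint (messages A ip F) (messages A ip G) (phi_one A ip F G \<phi>) l))"
  unfolding Delta_MP_def
proof (rule phi_one_delta_op[symmetric])
  let ?l = "adjoint (messages A ip F) (messages A ip G) (phi_one A ip F G \<phi>) l"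
  fix a assume a: "a \<in> A"
  show "g_op A ip F H (zeta_op A ip F (d_op A ip F ?l)) a \<in> ob F a \<rightarrow>\<^sub>E UNIV"
    by (rule g_op_closed[OF a])
  show "g_op A ip G (psi A F G \<phi> H) (zeta_op A ip G (d_op A ip G l)) a
      = push a (g_op A ip F H (zeta_op A ip F (d_op A ip F ?l)) a)"
  proof (rule push_g_op[symmetric, OF H a])
    show "zeta_op A ip G (d_op A ip G l) a \<in> ob G a \<rightarrow>\<^sub>E UNIV"
      by (rule zeta_op_closed[OF G a]) (rule d_op_closed[OF G l])
    show "zeta_op A ip F (d_op A ip F ?l) a = pull a (zeta_op A ip G (d_op A ip G l) a)"
      by (rule zeta_op_pull[OF a]) (erule d_op_closed[OF G l], erule d_op_pull[OF l])
  qed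
qed

end

section \<open>Functoriality\<close>

lemma nat_trans_PiE: "\<phi> \<in> nat_trans A F G \<Longrightarrow> \<phi> \<in> (\<Pi>\<^sub>E a\<in>A. ob F a \<rightarrow>\<^sub>E ob G a)"
  by (simp add: nat_trans_def)

lemma nat_trans_eqI:
  assumes "\<phi> \<in> nat_trans A F G" "\<theta> \<in> nat_trans A F G"
    and "\<And>a x. a \<in> A \<Longrightarrow> x \<in> ob F a \<Longrightarrow> \<phi> a x = \<theta> a x"
  shows "\<phi> = \<theta>"
proof (rule PiE_ext[OF nat_trans_PiE[OF assms(1)] nat_trans_PiE[OF assms(2)]])
  fix a assume a: "a \<in> A"
  show "\<phi> a = \<theta> a"
    by (rule PiE_ext[OF PiE_mem[OF nat_trans_PiE[OF assms(1)] a] PiE_mem[OF nat_trans_PiE[OF assms(2)] a]])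
      (rule assms(3)[OF a])
qed

lemma nat_trans_id:
  assumes F: "F \<in> presheaves A"
  shows "(\<lambda>a\<in>A. \<lambda>x\<in>ob F a. x) \<in> nat_trans A F F"
  using presheaf_res[OF F] by (auto simp: nat_trans_def dest: belowD)

lemma nat_trans_compose:
  assumes F: "F \<in> presheaves A" and \<phi>: "\<phi> \<in> nat_trans A F G" and \<theta>: "\<theta> \<in> nat_trans A G K"
  shows "(\<lambda>a\<in>A. compose (ob F a) (\<theta> a) (\<phi> a)) \<in> nat_trans A F K"
proof -
  have "res K (a, b) (\<theta> a (\<phi> a x)) = \<theta> b (\<phi> b (res F (a, b) x))"
    if "(a, b) \<in> below A" "x \<in> ob F a" for a b x
    using that belowD[OF that(1)]
    by (simp add: nat_trans_natural[OF \<theta>] nat_trans_natural[OF \<phi>] nat_trans_closed[OF \<phi>])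
  then show ?thesis
    using presheaf_res[OF F] nat_trans_closed[OF \<phi>] nat_trans_closed[OF \<theta>]
    by (auto simp: nat_trans_def compose_def dest: belowD)
qed

lemma category_Psh: "category (Psh A)"
proof
  fix F assume "F \<in> Obj (Psh A)"
  then show "Ident (Psh A) F \<in> Hom (Psh A) F F" by (simp add: Psh_def nat_trans_id)
next
  fix F G K \<phi> \<theta>
  assume "F \<in> Obj (Psh A)" "\<phi> \<in> Hom (Psh A) F G" "\<theta> \<in> Hom (Psh A) G K"
  then show "Comp (Psh A) F G K \<theta> \<phi> \<in> Hom (Psh A) F K" by (simp add: Psh_def nat_trans_compose)
next
  fix F G \<phi> assume FG: "F \<in> Obj (Psh A)" "G \<in> Obj (Psh A)" "\<phi> \<in> Hom (Psh A) F G"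
  then have F: "F \<in> presheaves A" and G: "G \<in> presheaves A" and \<phi>: "\<phi> \<in> nat_trans A F G"
    by (simp_all add: Psh_def)
  show "Comp (Psh A) F F G \<phi> (Ident (Psh A) F) = \<phi>"
    using nat_trans_compose[OF F nat_trans_id[OF F] \<phi>] \<phi>
    by (auto simp: Psh_def compose_def intro: nat_trans_eqI)
  show "Comp (Psh A) F G G (Ident (Psh A) G) \<phi> = \<phi>"
    using nat_trans_compose[OF F \<phi> nat_trans_id[OF G]] \<phi> nat_trans_closed[OF \<phi>]
    by (auto simp: Psh_def compose_def intro: nat_trans_eqI)
next
  fix E F G K \<phi> \<theta> \<kappa>
  assume "\<phi> \<in> Hom (Psh A) E F" "\<theta> \<in> Hom (Psh A) F G" "\<kappa> \<in> Hom (Psh A) G K"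
  then have "\<phi> \<in> nat_trans A E F" by (simp add: Psh_def)
  from nat_trans_closed[OF this]
  show "Comp (Psh A) E G K \<kappa> (Comp (Psh A) E F G \<theta> \<phi>)
      = Comp (Psh A) E F K (Comp (Psh A) F G K \<kappa> \<theta>) \<phi>"
    by (auto simp: Psh_def compose_def fun_eq_iff)
qed

section \<open>The functor on objects and arrows\<close>

context message_passing
begin

lemma MP_obj_simps [simp]:
  "hilb (MP_obj A ip F) = messages A ip F"
  "par (MP_obj A ip F) = hamiltonians A F"
  by (simp_all add: MP_obj_def)

lemma act_MP_obj:
  "\<lbrakk>l \<in> carrier (messages A ip F); H \<in> topspace (hamiltonians A F)\<rbrakk>
    \<Longrightarrow> act (MP_obj A ip F) (l, H) = Delta_MP A ip F H l"
  by (simp add: MP_obj_def)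

lemma mpa_obj_MP_obj:
  assumes F: "F \<in> presheaves A"
  shows "mpa_obj (MP_obj A ip F)"
proof -
  have "act (MP_obj A ip F)
      \<in> carrier (messages A ip F) \<times> topspace (hamiltonians A F) \<rightarrow>\<^sub>E carrier (messages A ip F)"
    unfolding MP_obj_def using Delta_MP_closed[OF F] by (auto simp del: topspace_hamiltonians)
  then show ?thesis by (simp add: mpa_obj_def hilbert_messages[OF F])
qed

lemma MP_arr_in_mpa_hom:
  assumes F: "F \<in> presheaves A" and G: "G \<in> presheaves A" and \<phi>: "\<phi> \<in> nat_trans A F G"
  shows "MP_arr A ip F G \<phi> \<in> mpa_hom (MP_obj A ip F) (MP_obj A ip G)"
proof -
  interpret message_passing_morphism A ip F G \<phi> by unfold_locales (fact F G \<phi>)+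
  let ?\<alpha> = "phi_one A ip F G \<phi>"
  have "act (MP_obj A ip G) (l, psi A F G \<phi> H)
      = ?\<alpha> (act (MP_obj A ip F) (adjoint (messages A ip F) (messages A ip G) ?\<alpha> l, H))"
    if l: "l \<in> carrier (messages A ip G)" and H: "H \<in> topspace (hamiltonians A F)" for l H
    unfolding act_MP_obj[OF l psi_closed[OF H]]
      act_MP_obj[OF adjoint_closed[OF hilbert_messages[OF F] messages_ip[OF G] bounded_phi_one l] H]
    by (rule Delta_MP_natural[OF l H])
  moreover have "psi A F G \<phi> \<in> extensional (topspace (hamiltonians A F))"
    unfolding psi_def by (rule restrict_extensional)
  ultimately show ?thesis
    using bounded_phi_one continuous_map_psi[OF presheaf_finite[OF F]]
    by (simp add: mpa_hom_def MP_arr_def del: topspace_hamiltonians)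
qed

lemma phi_one_id:
  "phi_one A ip F F (\<lambda>a\<in>A. \<lambda>x\<in>ob F a. x) = (\<lambda>l\<in>carrier (messages A ip F). l)"
proof -
  have "(\<lambda>(a, b)\<in>below A. pushforward (ob F b) (ob F b) ((\<lambda>a\<in>A. \<lambda>x\<in>ob F a. x) b) (l (a, b))) = l"
    if l: "l \<in> carrier (messages A ip F)" for l
  proof -
    have l': "l \<in> (\<Pi>\<^sub>E (a, b)\<in>below A. ob F b \<rightarrow>\<^sub>E UNIV)" using l unfolding messages_carrier .
    have "pushforward (ob F b) (ob F b) ((\<lambda>a\<in>A. \<lambda>x\<in>ob F a. x) b) (l (a, b)) = l (a, b)"
      if ab: "(a, b) \<in> below A" for a b
    proof -
      have "pushforward (ob F b) (ob F b) ((\<lambda>a\<in>A. \<lambda>x\<in>ob F a. x) b)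
          = pushforward (ob F b) (ob F b) (\<lambda>x. x)"
        by (rule pushforward_cong) (use belowD[OF ab] in simp)
      then show ?thesis using pushforward_id PiE_mem[OF l' ab] by simp
    qed
    then show ?thesis using l' by (auto simp: fun_eq_iff PiE_iff extensional_def)
  qed
  then show ?thesis unfolding phi_one_def by (rule restrict_ext)
qed

text \<open>Fibres of the identity are singletons, so the claim reduces to
  \<open>ln_ext_exp_ext\<close>. Membership of \<open>H\<close> in the parameter space excludes the
  value \<open>- \<infinity>\<close>, where that cancellation fails.\<close>

lemma psi_id:
  "psi A F F (\<lambda>a\<in>A. \<lambda>x\<in>ob F a. x) = (\<lambda>H\<in>topspace (hamiltonians A F). H)"
proof -
  have "(\<lambda>a\<in>A. \<lambda>y\<in>ob F a.
      - ln_ext (\<Sum>x\<in>{x \<in> ob F a. (\<lambda>a\<in>A. \<lambda>x\<in>ob F a. x) a x = y}. exp_ext (- H a x))) = H"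
    (is "?L = H") if H: "H \<in> topspace (hamiltonians A F)" for H
  proof -
    have H': "H \<in> (\<Pi>\<^sub>E a\<in>A. \<Pi>\<^sub>E x\<in>ob F a. {h. h \<noteq> - \<infinity>})" using H by simp
    show ?thesis
    proof (rule PiE_ext[OF _ H'])
      show "?L \<in> (\<Pi>\<^sub>E a\<in>A. \<Pi>\<^sub>E x\<in>ob F a. {h. h \<noteq> - \<infinity>})" by auto
      fix a assume a: "a \<in> A"
      show "?L a = H a"
      proof (rule PiE_ext[OF _ PiE_mem[OF H' a]])
        show "?L a \<in> (\<Pi>\<^sub>E x\<in>ob F a. {h. h \<noteq> - \<infinity>})" using a by auto
        fix y assume y: "y \<in> ob F a"
        have "{x \<in> ob F a. (\<lambda>a\<in>A. \<lambda>x\<in>ob F a. x) a x = y} = {y}" using a y by auto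
        then show "?L a y = H a y"
          using a y PiE_mem[OF PiE_mem[OF H' a] y] by simp
      qed
    qed
  qed
  then show ?thesis unfolding psi_def by (rule restrict_ext)
qed

lemma phi_one_compose:
  assumes F: "F \<in> presheaves A" and G: "G \<in> presheaves A" and K: "K \<in> presheaves A"
    and \<phi>: "\<phi> \<in> nat_trans A F G" and \<theta>: "\<theta> \<in> nat_trans A G K"
  shows "phi_one A ip F K (\<lambda>a\<in>A. compose (ob F a) (\<theta> a) (\<phi> a))
    = compose (carrier (messages A ip F)) (phi_one A ip G K \<theta>) (phi_one A ip F G \<phi>)"
proof -
  interpret message_passing_morphism A ip F G \<phi> by unfold_locales (fact F G \<phi>)+
  have "(\<lambda>(a, b)\<in>below A. pushforward (ob F b) (ob K b) ((\<lambda>a\<in>A. compose (ob F a) (\<theta> a) (\<phi> a)) b) (l (a, b)))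
      = phi_one A ip G K \<theta> (phi_one A ip F G \<phi> l)"
    (is "?L = ?R") if l: "l \<in> carrier (messages A ip F)" for l
  proof
    fix i :: "'a \<times> 'a"
    have l': "l (b, c) \<in> ob F c \<rightarrow>\<^sub>E UNIV" if "(b, c) \<in> below A" for b c
      using l that unfolding messages_carrier by (auto dest: PiE_mem)
    have closed: "phi_one A ip F G \<phi> l \<in> carrier (messages A ip G)"
      by (rule bounded_linear_map_closed[OF bounded_phi_one l])
    obtain a b where i: "i = (a, b)" by fastforce
    show "?L i = ?R i"
    proof (cases "(a, b) \<in> below A")
      case True
      then have a: "a \<in> A" and b: "b \<in> A" by (auto dest: belowD)
      have "pushforward (ob F b) (ob K b) ((\<lambda>a\<in>A. compose (ob F a) (\<theta> a) (\<phi> a)) b)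
          = pushforward (ob F b) (ob K b) (\<lambda>x. \<theta> b (\<phi> b x))"
        by (rule pushforward_cong) (simp add: b compose_def)
      moreover have "pushforward (ob F b) (ob K b) (\<lambda>x. \<theta> b (\<phi> b x)) (l (a, b))
          = pushforward (ob G b) (ob K b) (\<theta> b) (pushforward (ob F b) (ob G b) (\<phi> b) (l (a, b)))"
        by (rule pushforward_compose[symmetric, OF presheaf_finite[OF F b] presheaf_finite[OF G b]
              nat_trans_closed[OF \<phi> b] l'[OF True]])
      ultimately have "?L i
          = pushforward (ob G b) (ob K b) (\<theta> b) (pushforward (ob F b) (ob G b) (\<phi> b) (l (a, b)))"
        unfolding i using True by simp
      also have "pushforward (ob F b) (ob G b) (\<phi> b) (l (a, b)) = phi_one A ip F G \<phi> l (a, b)"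
        using l True by (simp add: phi_one_def)
      also have "pushforward (ob G b) (ob K b) (\<theta> b) \<dots> = ?R i"
        unfolding i phi_one_def[of A ip G] using closed True by simp
      finally show ?thesis .
    next
      case False
      then show ?thesis unfolding i phi_one_def[of A ip G] using closed by simp
    qed
  qed
  then show ?thesis unfolding phi_one_def[of A ip F K] compose_def by (rule restrict_ext)
qed

text \<open>By \<open>exp_ext_psi\<close> the weight cancels the intermediate logarithm; what
  remains is the sum over a fibre of the composite, grouped by the intermediate value
  \<open>\<phi> a x\<close>.\<close>

lemma psi_compose:
  assumes F: "F \<in> presheaves A" and G: "G \<in> presheaves A" and \<phi>: "\<phi> \<in> nat_trans A F G"
  shows "psi A F K (\<lambda>a\<in>A. compose (ob F a) (\<theta> a) (\<phi> a))
    = compose (topspace (hamiltonians A F)) (psi A G K \<theta>) (psi A F G \<phi>)"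
proof -
  have "(\<lambda>a\<in>A. \<lambda>z\<in>ob K a.
        - ln_ext (\<Sum>x\<in>{x \<in> ob F a. (\<lambda>a\<in>A. compose (ob F a) (\<theta> a) (\<phi> a)) a x = z}. exp_ext (- H a x)))
      = psi A G K \<theta> (psi A F G \<phi> H)"
    (is "?L = ?R") if H: "H \<in> topspace (hamiltonians A F)" for H
  proof -
    have psi: "psi A F G \<phi> H \<in> topspace (hamiltonians A G)" by (rule psi_closed[OF H])
    have sum: "(\<Sum>x\<in>{x \<in> ob F a. (\<lambda>a\<in>A. compose (ob F a) (\<theta> a) (\<phi> a)) a x = z}. exp_ext (- H a x))
        = (\<Sum>y\<in>{y \<in> ob G a. \<theta> a y = z}. exp_ext (- psi A F G \<phi> H a y))" if a: "a \<in> A" for a z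
    proof -
      have "(\<Sum>y\<in>{y \<in> ob G a. \<theta> a y = z}. exp_ext (- psi A F G \<phi> H a y))
          = (\<Sum>y\<in>{y \<in> ob G a. \<theta> a y = z}. \<Sum>x\<in>{x \<in> {x \<in> ob F a. \<theta> a (\<phi> a x) = z}. \<phi> a x = y}. exp_ext (- H a x))"
        by (intro sum.cong refl) (auto simp: exp_ext_psi[OF H a] intro!: sum.cong)
      also have "\<dots> = (\<Sum>x\<in>{x \<in> ob F a. \<theta> a (\<phi> a x) = z}. exp_ext (- H a x))"
        by (rule sum.group)
          (use presheaf_finite[OF F a] presheaf_finite[OF G a] nat_trans_closed[OF \<phi> a] in auto)
      also have "{x \<in> ob F a. \<theta> a (\<phi> a x) = z}
          = {x \<in> ob F a. (\<lambda>a\<in>A. compose (ob F a) (\<theta> a) (\<phi> a)) a x = z}"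
        using a by (auto simp: compose_def)
      finally show ?thesis by simp
    qed
    have "?R = (\<lambda>a\<in>A. \<lambda>z\<in>ob K a.
        - ln_ext (\<Sum>y\<in>{y \<in> ob G a. \<theta> a y = z}. exp_ext (- psi A F G \<phi> H a y)))"
      unfolding psi_def[of A G] using psi by (rule restrict_apply')
    also have "\<dots> = ?L" by (intro restrict_ext) (simp only: sum)
    finally show ?thesis by simp
  qed
  then show ?thesis unfolding psi_def[of A F K] compose_def by (rule restrict_ext)
qed

lemma functor_MP: "category_functor (Psh A) MPA (MP_obj A ip) (MP_arr A ip)"
proof (intro category_functor.intro category_Psh category_MPA category_functor_axioms.intro)
  fix F :: "('a, 'x) presheaf" assume "F \<in> Obj (Psh A)"
  then show "MP_obj A ip F \<in> Obj MPA" by (simp add: MPA_def Psh_def mpa_obj_MP_obj)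
  show "MP_arr A ip F F (Ident (Psh A) F) = Ident MPA (MP_obj A ip F)"
    by (simp add: MPA_def Psh_def MP_arr_def phi_one_id psi_id del: topspace_hamiltonians)
next
  fix F G :: "('a, 'x) presheaf" and \<phi>
  assume "F \<in> Obj (Psh A)" "G \<in> Obj (Psh A)" "\<phi> \<in> Hom (Psh A) F G"
  then show "MP_arr A ip F G \<phi> \<in> Hom MPA (MP_obj A ip F) (MP_obj A ip G)"
    by (simp add: MPA_def Psh_def MP_arr_in_mpa_hom)
next
  fix F G K :: "('a, 'x) presheaf" and \<phi> \<theta>
  assume "F \<in> Obj (Psh A)" "G \<in> Obj (Psh A)" "K \<in> Obj (Psh A)"
    "\<phi> \<in> Hom (Psh A) F G" "\<theta> \<in> Hom (Psh A) G K"
  then show "MP_arr A ip F K (Comp (Psh A) F G K \<theta> \<phi>) = Comp MPA (MP_obj A ip F) (MP_obj A ip G)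
      (MP_obj A ip K) (MP_arr A ip G K \<theta>) (MP_arr A ip F G \<phi>)"
    by (simp add: MPA_def Psh_def MP_arr_def phi_one_compose psi_compose del: topspace_hamiltonians)
qed

end

theorem theorem2:
  fixes A :: "'a::order set" and ip :: "('a, 'x) scalar_products"
  assumes "finite A"
    and "\<And>F a. F \<in> presheaves A \<Longrightarrow> a \<in> A \<Longrightarrow> inner_product_space (lin ip F a)"
  shows "(\<forall>F\<in>presheaves A. \<forall>G\<in>presheaves A. \<forall>\<phi>\<in>nat_trans A F G.
            MP_arr A ip F G \<phi> \<in> Hom MPA (MP_obj A ip F) (MP_obj A ip G)) \<and>
         category_functor (Psh A) MPA (MP_obj A ip) (MP_arr A ip)"
proof -
  interpret message_passing A ip using assms by (rule message_passing.intro)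
  show ?thesis using functor_MP by (simp add: MPA_def MP_arr_in_mpa_hom)
qed

end
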